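(* Let $(k^{(p)})_{p\ge1}$ be a sequence of kernels ($k=k^{(p)}$ on $\mathbb{R}^p$) with $\mathbb{E}[k^4(Z_1,Z_2)]<\infty$ for each $p$, and suppose $n/N=\rho+O(1/N^s)$ as $n,m\to\infty$ for some $0<\rho<1$ and $s>0$, where $N=n+m$. If for some constant $0<\tau\le1$, as $n,m,p\to\infty$, $$\frac{|\mathcal{E}^k(X,Y)|^{2+2\tau}}{N^{\tau}(\mathcal{V}_k^2(Z))^{1+\tau}}\to0,\qquad \frac{\mathbb{E}[k^2(Z_1,Z_2)]}{N^s\,\mathcal{V}_k^2(Z)}\to0,$$ $$\frac{\mathbb{E}\big[|\tilde k(X_1,X_2)|^{2+2\tau}+|\tilde k(X_1,Y_1)|^{2+2\tau}+|\tilde k(Y_1,Y_2)|^{2+2\tau}\big]}{N^\tau(\mathcal{V}_k^2(Z))^{1+\tau}}\to0,$$ $$\frac{N(\mathcal{E}^k(X,Y))^2}{\mathbb{E}\big[(h^k(X_1,X_2,Y_1,Y_2))^2\big]}\to\infty,\qquad \frac{N\,\mathcal{E}^k(X,Y)}{\sqrt{\mathcal{V}_k^2(Z)}}\to\infty,$$ then for any $C>0$, $\mathbb{P}(T_{n,m,p}^k>C)\to1$ as $n,m,p\to\infty$.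
   Context: Kernel: a kernel on $\mathbb{R}^p$ is a symmetric function $k:\mathbb{R}^p\times\mathbb{R}^p\to\mathbb{R}$ satisfying either (a) $k\ge0$, $k(x,y)=0$ iff $x=y$, and for all Borel probability measures $P\ne Q$ with $\int k(z,z_0)\,dP(z)<\infty$ and $\int k(z,z_0)\,dQ(z)<\infty$ for some $z_0$, one has $\int k\,d([P-Q]\times[P-Q])<0$; or (b) $-k$ is the reproducing kernel of an RKHS on $\mathbb{R}^p$ and is characteristic (the mean embedding map on Borel probability measures is injective). It is assumed that $k(x,x)=a_0^k$ is a finite constant not depending on $x$. Sampling: for each $p$, $X,Y$ are random vectors in $\mathbb{R}^p$; $X_1,\dots,X_n$ are i.i.d. copies of $X$, $Y_1,\dots,Y_m$ are i.i.d. copies of $Y$, the two samples are independent. $Z$ is the mixture equal to $X$ with probability $\rho$ and to $Y$ with probability $1-\rho$; $Z_1,Z_2,\dots$ are i.i.d. copies of $Z$. Notation: $\tilde k(U,V)=k(U,V)-\mathbb{E}[k(U,V)]$ for each of the pairs $(X_1,X_2),(X_1,Y_1),(Y_1,Y_2)$; $\mathcal{E}^k(X,Y)=2\mathbb{E}[k(X_1,Y_1)]-\mathbb{E}[k(X_1,X_2)]-\mathbb{E}[k(Y_1,Y_2)]$; $h^k(X_1,X_2,Y_1,Y_2)=\frac12\sum_{i=1}^2\sum_{j=1}^2k(X_i,Y_j)-k(X_1,X_2)-k(Y_1,Y_2)$; $\mathcal{V}_k^2(Z)=\mathbb{E}[k^2(Z_1,Z_2)]-2\mathbb{E}[k(Z_1,Z_2)k(Z_1,Z_3)]+(\mathbb{E}[k(Z_1,Z_2)])^2$.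 Test statistic: $\mathcal{E}_{n,m}^k(X,Y)=\frac{2}{nm}\sum_{i=1}^n\sum_{j=1}^m k(X_i,Y_j)-\binom n2^{-1}\sum_{1\le i<j\le n}k(X_i,X_j)-\binom m2^{-1}\sum_{1\le i<j\le m}k(Y_i,Y_j)$; $c_{n,m}=\frac{2}{n(n-1)}+\frac{4}{nm}+\frac{2}{m(m-1)}$. Let $W_1,\dots,W_N$ be the pooled sample ($W_s=X_s$ for $s\le n$, $W_s=Y_{s-n}$ for $s>n$), $a_{s,t}=k(W_s,W_t)$ for $1\le s,t\le N$, $\tilde a_{\cdot t}=\frac{1}{N-2}\sum_{i=1}^N a_{i,t}$, $\tilde a_{s\cdot}=\frac1{N-2}\sum_{j=1}^Na_{s,j}$, $\tilde a_{\cdot\cdot}=\frac{1}{(N-1)(N-2)}\sum_{i,j=1}^Na_{i,j}$, $A^*_{s,t}=a_{s,t}-\tilde a_{\cdot t}-\tilde a_{s\cdot}+\tilde a_{\cdot\cdot}$, and $\mathcal{V}_{n,m}^{k*}(X,Y)=\frac{1}{N(N-3)}\sum_{s\ne t}(A^*_{s,t})^2-\frac{(a_0^k)^2}{(N-1)(N-3)}$. Finally $T_{n,m,p}^k=\mathcal{E}_{n,m}^k(X,Y)\big/\sqrt{c_{n,m}\mathcal{V}_{n,m}^{k*}(X,Y)}$. *)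

theory Defs
  imports "HOL-Probability.Probability" "HOL-Library.Landau_Symbols"
begin

(* The dimension p tends to infinity inside the theorem, so vectors are functions on {..<p}
   (undefined elsewhere), equipped with the Borel sigma-algebra of R^p. *)
definition euclid :: "nat \<Rightarrow> (nat \<Rightarrow> real) measure" where
  "euclid p = (\<Pi>\<^sub>M i\<in>{..<p}. borel)"

definition borel_probs :: "nat \<Rightarrow> (nat \<Rightarrow> real) measure set" where
  "borel_probs p = {P. prob_space P \<and> sets P = sets (euclid p)}"


subsection \<open>Reproducing kernel Hilbert spaces\<close>

(* H is a real Hilbert space of functions on S with inner product ip; its elements are
   represented as extensional functions, so all operations are restricted to S. *)
locale rkhs =
  fixes S :: "'v set" and K :: "'v \<Rightarrow> 'v \<Rightarrow> real"
    and H :: "('v \<Rightarrow> real) set" and ip :: "('v \<Rightarrow> real) \<Rightarrow> ('v \<Rightarrow> real) \<Rightarrow> real"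
  assumes carrier: "H \<subseteq> extensional S"
    and zero_mem: "(\<lambda>x\<in>S. 0) \<in> H"
    and add_mem: "\<lbrakk>f \<in> H; g \<in> H\<rbrakk> \<Longrightarrow> (\<lambda>x\<in>S. f x + g x) \<in> H"
    and scale_mem: "f \<in> H \<Longrightarrow> (\<lambda>x\<in>S. c * f x) \<in> H"
    and ip_add: "\<lbrakk>f \<in> H; g \<in> H; u \<in> H\<rbrakk> \<Longrightarrow> ip (\<lambda>x\<in>S. f x + g x) u = ip f u + ip g u"
    and ip_scale: "\<lbrakk>f \<in> H; u \<in> H\<rbrakk> \<Longrightarrow> ip (\<lambda>x\<in>S. c * f x) u = c * ip f u"
    and ip_commute: "\<lbrakk>f \<in> H; g \<in> H\<rbrakk> \<Longrightarrow> ip f g = ip g f"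
    and ip_nonneg: "f \<in> H \<Longrightarrow> 0 \<le> ip f f"
    and ip_definite: "\<lbrakk>f \<in> H; ip f f = 0\<rbrakk> \<Longrightarrow> f = (\<lambda>x\<in>S. 0)"
    and complete: "Metric_space.mcomplete H
          (\<lambda>f g. sqrt (ip (\<lambda>x\<in>S. f x - g x) (\<lambda>x\<in>S. f x - g x)))"
    and section_mem: "x \<in> S \<Longrightarrow> (\<lambda>y\<in>S. K y x) \<in> H"
    and reproducing: "\<lbrakk>x \<in> S; f \<in> H\<rbrakk> \<Longrightarrow> ip f (\<lambda>y\<in>S. K y x) = f x"

(* The Riesz representer in H of integration against P.  It exists and is unique whenever K is
   measurable and bounded, which is the case for kernels with constant diagonal. *)
definition mean_embedding ::
  "('v \<Rightarrow> real) set \<Rightarrow> (('v \<Rightarrow> real) \<Rightarrow> ('v \<Rightarrow> real) \<Rightarrow> real) \<Rightarrow> 'v measure \<Rightarrow> ('v \<Rightarrow> real)" where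
  "mean_embedding H ip P = (THE \<mu>. \<mu> \<in> H \<and> (\<forall>f\<in>H. (\<integral>x. f x \<partial>P) = ip f \<mu>))"

definition characteristic_kernel :: "nat \<Rightarrow> ((nat \<Rightarrow> real) \<Rightarrow> (nat \<Rightarrow> real) \<Rightarrow> real) \<Rightarrow> bool" where
  "characteristic_kernel p K \<longleftrightarrow>
     (\<exists>H ip. rkhs (space (euclid p)) K H ip \<and> inj_on (mean_embedding H ip) (borel_probs p))"


subsection \<open>Kernels\<close>

(* The integral of k against (P - Q) x (P - Q), expanded over the four product measures. *)
definition signed_diff_integral ::
  "('v \<Rightarrow> 'v \<Rightarrow> real) \<Rightarrow> 'v measure \<Rightarrow> 'v measure \<Rightarrow> real" where
  "signed_diff_integral k P Q =
     (\<integral>z. case_prod k z \<partial>(P \<Otimes>\<^sub>M P)) - (\<integral>z. case_prod k z \<partial>(P \<Otimes>\<^sub>M Q))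
     - (\<integral>z. case_prod k z \<partial>(Q \<Otimes>\<^sub>M P)) + (\<integral>z. case_prod k z \<partial>(Q \<Otimes>\<^sub>M Q))"

definition strong_negative_type :: "nat \<Rightarrow> ((nat \<Rightarrow> real) \<Rightarrow> (nat \<Rightarrow> real) \<Rightarrow> real) \<Rightarrow> bool" where
  "strong_negative_type p k \<longleftrightarrow>
     (\<forall>x\<in>space (euclid p). \<forall>y\<in>space (euclid p). 0 \<le> k x y \<and> (k x y = 0 \<longleftrightarrow> x = y)) \<and>
     (\<forall>P\<in>borel_probs p. \<forall>Q\<in>borel_probs p. P \<noteq> Q \<longrightarrow>
        (\<exists>z0\<in>space (euclid p). integrable P (\<lambda>z. k z z0) \<and> integrable Q (\<lambda>z. k z z0)) \<longrightarrow>
        signed_diff_integral k P Q < 0)"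

(* Joint Borel measurability is what makes the integrals of k meaningful. *)
definition kernel_on :: "nat \<Rightarrow> ((nat \<Rightarrow> real) \<Rightarrow> (nat \<Rightarrow> real) \<Rightarrow> real) \<Rightarrow> bool" where
  "kernel_on p k \<longleftrightarrow>
     case_prod k \<in> borel_measurable (euclid p \<Otimes>\<^sub>M euclid p) \<and>
     (\<forall>x\<in>space (euclid p). \<forall>y\<in>space (euclid p). k x y = k y x) \<and>
     (strong_negative_type p k \<or> characteristic_kernel p (\<lambda>x y. - k x y))"


subsection \<open>Sampling model\<close>

(* Indices start at 1.  Joint independence over the disjoint union of the two index sets says
   that each sample is independent and that the two samples are independent of each other. *)
locale two_sample = prob_space M
  for M :: "'a measure" +
  fixes p :: nat and \<rho> :: real and X Y Z :: "nat \<Rightarrow> 'a \<Rightarrow> (nat \<Rightarrow> real)"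
  assumes indep_XY: "indep_vars (\<lambda>_. euclid p) (case_sum X Y) ({1..} <+> {1..})"
    and ident_X: "i \<ge> 1 \<Longrightarrow> distr M (euclid p) (X i) = distr M (euclid p) (X 1)"
    and ident_Y: "i \<ge> 1 \<Longrightarrow> distr M (euclid p) (Y i) = distr M (euclid p) (Y 1)"
    and indep_Z: "indep_vars (\<lambda>_. euclid p) Z {1..}"
    and mixture_Z: "\<lbrakk>i \<ge> 1; A \<in> sets (euclid p)\<rbrakk> \<Longrightarrow>
      \<P>(\<omega> in M. Z i \<omega> \<in> A) = \<rho> * \<P>(\<omega> in M. X 1 \<omega> \<in> A) + (1 - \<rho>) * \<P>(\<omega> in M. Y 1 \<omega> \<in> A)"


subsection \<open>Population quantities\<close>

definition centered ::
  "'a measure \<Rightarrow> ('v \<Rightarrow> 'v \<Rightarrow> real) \<Rightarrow> ('a \<Rightarrow> 'v) \<Rightarrow> ('a \<Rightarrow> 'v) \<Rightarrow> 'a \<Rightarrow> real" where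
  "centered M k U V \<omega> = k (U \<omega>) (V \<omega>) - (\<integral>\<omega>'. k (U \<omega>') (V \<omega>') \<partial>M)"

definition energy_dist ::
  "'a measure \<Rightarrow> ('v \<Rightarrow> 'v \<Rightarrow> real) \<Rightarrow> (nat \<Rightarrow> 'a \<Rightarrow> 'v) \<Rightarrow> (nat \<Rightarrow> 'a \<Rightarrow> 'v) \<Rightarrow> real" where
  "energy_dist M k X Y =
     2 * (\<integral>\<omega>. k (X 1 \<omega>) (Y 1 \<omega>) \<partial>M)
     - (\<integral>\<omega>. k (X 1 \<omega>) (X 2 \<omega>) \<partial>M) - (\<integral>\<omega>. k (Y 1 \<omega>) (Y 2 \<omega>) \<partial>M)"

definition h_kernel :: "('v \<Rightarrow> 'v \<Rightarrow> real) \<Rightarrow> 'v \<Rightarrow> 'v \<Rightarrow> 'v \<Rightarrow> 'v \<Rightarrow> real" where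
  "h_kernel k x1 x2 y1 y2 =
     1 / 2 * (k x1 y1 + k x1 y2 + k x2 y1 + k x2 y2) - k x1 x2 - k y1 y2"

definition dvar2 :: "'a measure \<Rightarrow> ('v \<Rightarrow> 'v \<Rightarrow> real) \<Rightarrow> (nat \<Rightarrow> 'a \<Rightarrow> 'v) \<Rightarrow> real" where
  "dvar2 M k Z =
     (\<integral>\<omega>. (k (Z 1 \<omega>) (Z 2 \<omega>))\<^sup>2 \<partial>M)
     - 2 * (\<integral>\<omega>. k (Z 1 \<omega>) (Z 2 \<omega>) * k (Z 1 \<omega>) (Z 3 \<omega>) \<partial>M)
     + (\<integral>\<omega>. k (Z 1 \<omega>) (Z 2 \<omega>) \<partial>M)\<^sup>2"


subsection \<open>Test statistic, as a function of the observed values\<close>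

definition energy_stat ::
  "('v \<Rightarrow> 'v \<Rightarrow> real) \<Rightarrow> nat \<Rightarrow> nat \<Rightarrow> (nat \<Rightarrow> 'v) \<Rightarrow> (nat \<Rightarrow> 'v) \<Rightarrow> real" where
  "energy_stat k n m x y =
     2 / (real n * real m) * (\<Sum>i=1..n. \<Sum>j=1..m. k (x i) (y j))
     - 1 / real (n choose 2) * (\<Sum>j=1..n. \<Sum>i=1..<j. k (x i) (x j))
     - 1 / real (m choose 2) * (\<Sum>j=1..m. \<Sum>i=1..<j. k (y i) (y j))"

definition c_norm :: "nat \<Rightarrow> nat \<Rightarrow> real" where
  "c_norm n m = 2 / (real n * (real n - 1)) + 4 / (real n * real m) + 2 / (real m * (real m - 1))"

definition pooled :: "nat \<Rightarrow> (nat \<Rightarrow> 'v) \<Rightarrow> (nat \<Rightarrow> 'v) \<Rightarrow> nat \<Rightarrow> 'v" where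
  "pooled n x y s = (if s \<le> n then x s else y (s - n))"

(* U-centering of the array a(s,t), 1 <= s,t <= N *)
definition u_centered :: "nat \<Rightarrow> (nat \<Rightarrow> nat \<Rightarrow> real) \<Rightarrow> nat \<Rightarrow> nat \<Rightarrow> real" where
  "u_centered N a s t =
     a s t
     - 1 / (real N - 2) * (\<Sum>i=1..N. a i t)
     - 1 / (real N - 2) * (\<Sum>j=1..N. a s j)
     + 1 / ((real N - 1) * (real N - 2)) * (\<Sum>i=1..N. \<Sum>j=1..N. a i j)"

definition var_stat ::
  "('v \<Rightarrow> 'v \<Rightarrow> real) \<Rightarrow> real \<Rightarrow> nat \<Rightarrow> nat \<Rightarrow> (nat \<Rightarrow> 'v) \<Rightarrow> (nat \<Rightarrow> 'v) \<Rightarrow> real" where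
  "var_stat k a0 n m x y =
     (let N = n + m; a = (\<lambda>s t. k (pooled n x y s) (pooled n x y t))
      in 1 / (real N * (real N - 3)) * (\<Sum>s=1..N. \<Sum>t\<in>{1..N} - {s}. (u_centered N a s t)\<^sup>2)
         - a0\<^sup>2 / ((real N - 1) * (real N - 3)))"

definition T_stat ::
  "('v \<Rightarrow> 'v \<Rightarrow> real) \<Rightarrow> real \<Rightarrow> nat \<Rightarrow> nat \<Rightarrow> (nat \<Rightarrow> 'v) \<Rightarrow> (nat \<Rightarrow> 'v) \<Rightarrow> real" where
  "T_stat k a0 n m x y = energy_stat k n m x y / sqrt (c_norm n m * var_stat k a0 n m x y)"

end

theory Submission imports Defs begin

text \<open>
  The statistic exceeds \<open>C\<close> as soon as its numerator is at least half of its mean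
  \<open>\<E>\<close> and its variance estimator \<open>V*\<close> is positive and at most a suitable
  multiple \<open>R V\<^sup>2\<close> of the population value. The factor \<open>R = N \<E> / V\<close>,
  which tends to infinity, can be allowed because \<open>c\<^sub>n\<^sub>,\<^sub>m\<close> has order \<open>1 / N\<^sup>2\<close>:
  then \<open>C sqrt (c\<^sub>n\<^sub>,\<^sub>m R V\<^sup>2)\<close> has order \<open>C \<E> / sqrt R\<close>, which falls below
  \<open>\<E> / 2\<close>. This leaves three probability bounds.

  The numerator is the average of \<open>h\<close> over all pairs of pairs of observations. Two terms
  with no observation in common are independent, and all but a fraction of order \<open>1 / N\<close> of
  the pairs of terms are of this kind, so the variance is at most \<open>E h\<^sup>2\<close> times a constant
  over \<open>N\<close>, and Chebyshev's inequality applies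
  (\<open>prob_energy_est_deviation_le\<close>).

  The variance estimator is studied through the four-point contrast
  \<open>quad k w x y z = k w x + k y z - k w y - k x z\<close>. For four independent draws from the mixture
  its second moment is exactly \<open>4 V\<^sup>2\<close>. Apart from the contribution of the diagonal,
  every U-centred entry is an average of contrasts times a factor below one, and each component of the mixture is dominated by a multiple of the mixture, so
  \<open>E V* \<le> const V\<^sup>2\<close> and Markov's inequality gives \<open>V* < R V\<^sup>2\<close> with probability
  close to one (\<open>prob_var_est_ge_le\<close>).

  The estimator is a sum of squares, and it vanishes only if all contrasts of the pooled sample
  vanish. By averaging over the \<open>2\<^sup>4\<close> label patterns, some pattern has a contrast with second
  moment at least \<open>4 V\<^sup>2\<close>, while its moment of order \<open>2 + 2 \<tau>\<close> is
  \<open>o (N\<^sup>\<tau> V\<^sup>2\<^sup>+\<^sup>2\<^sup>\<tau>)\<close>; truncation shows that \<open>N\<close> times the probability of a nonzero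
  contrast tends to infinity. Disjoint blocks of observations provide a number of independent
  contrasts proportional to \<open>N\<close>, so with probability tending to one at least one of them is
  nonzero (\<open>exists_block_quad_prob_ge\<close>, \<open>prob_var_est_zero_le\<close>).
\<close>

section \<open>U-centring of a symmetric array\<close>

text \<open>
  A four-point contrast: it annihilates every array of the form \<open>u s + u t\<close>, and is therefore
  unaffected by double centring.
\<close>

definition quad :: "('v \<Rightarrow> 'v \<Rightarrow> real) \<Rightarrow> 'v \<Rightarrow> 'v \<Rightarrow> 'v \<Rightarrow> 'v \<Rightarrow> real" where
  "quad k w x y z = k w x + k y z - k w y - k x z"

locale symmetric_array =
  fixes N :: nat and a :: "nat \<Rightarrow> nat \<Rightarrow> real" and c :: real
  assumes size: "4 \<le> N"
    and sym: "\<lbrakk>s \<in> {1..N}; t \<in> {1..N}\<rbrakk> \<Longrightarrow> a s t = a t s"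
    and diag: "s \<in> {1..N} \<Longrightarrow> a s s = c"
begin

definition row :: "nat \<Rightarrow> real" where "row s = (\<Sum>j=1..N. a s j)"

definition total :: real where "total = (\<Sum>s=1..N. row s)"

text \<open>
  The constant diagonal \<open>c\<close> enters the row means, so each U-centred off-diagonal entry is
  lower by \<open>c / (N - 1)\<close> than it would be for the array with zero diagonal. Adding this back
  gives the version whose off-diagonal row sums vanish.
\<close>

definition offdiag_centered :: "nat \<Rightarrow> nat \<Rightarrow> real" where
  "offdiag_centered s t = u_centered N a s t + c / (real N - 1)"

lemma offdiag_centered_eq:
  assumes "s \<in> {1..N}" "t \<in> {1..N}"
  shows "offdiag_centered s t = a s t - row t / (real N - 2) - row s / (real N - 2)
     + total / ((real N - 1) * (real N - 2)) + c / (real N - 1)"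
proof -
  have "(\<Sum>i=1..N. a i t) = row t"
    unfolding row_def using assms sym by (intro sum.cong) auto
  moreover have "(\<Sum>i=1..N. \<Sum>j=1..N. a i j) = total"
    unfolding total_def row_def ..
  ultimately show ?thesis
    by (simp add: offdiag_centered_def u_centered_def row_def)
qed

lemma sum_offdiag_centered:
  assumes "s \<in> {1..N}"
  shows "(\<Sum>t\<in>{1..N} - {s}. offdiag_centered s t) = 0"
proof -
  have N: "real N - 1 \<noteq> 0" "real N - 2 \<noteq> 0" "real (N - Suc 0) = real N - 1"
    using size by auto
  have s1: "(\<Sum>t\<in>{1..N} - {s}. a s t) = row s - c"
    using assms diag[OF assms] by (simp add: row_def sum_diff1)
  have s2: "(\<Sum>t\<in>{1..N} - {s}. row t) = total - row s"
    using assms by (simp add: total_def sum_diff1)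
  have card: "card ({1..N} - {s}) = N - 1"
    using assms by simp
  have "(\<Sum>t\<in>{1..N} - {s}. offdiag_centered s t) =
    (\<Sum>t\<in>{1..N} - {s}. a s t - row t / (real N - 2) - row s / (real N - 2)
     + total / ((real N - 1) * (real N - 2)) + c / (real N - 1))"
    using assms by (intro sum.cong offdiag_centered_eq) auto
  also have "\<dots> = (row s - c) - (total - row s) / (real N - 2) - (real N - 1) * (row s / (real N - 2))
     + (real N - 1) * (total / ((real N - 1) * (real N - 2))) + (real N - 1) * (c / (real N - 1))"
    using s1 s2 card N(3) by (simp add: sum.distrib sum_subtractf flip: sum_divide_distrib)
  also have "\<dots> = 0"
    using N(1,2) by (simp add: divide_simps) (simp add: algebra_simps)
  finally show ?thesis .
qed

text \<open>
  Since rows sum to zero, the cross terms between \<open>offdiag_centered\<close> and the constant shift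
  vanish. The remaining contribution of the shift is what the diagonal correction of the variance
  estimator removes.
\<close>

lemma sum_u_centered_squares:
  "(\<Sum>s=1..N. \<Sum>t\<in>{1..N} - {s}. (u_centered N a s t)\<^sup>2) =
   (\<Sum>s=1..N. \<Sum>t\<in>{1..N} - {s}. (offdiag_centered s t)\<^sup>2) + real N * c\<^sup>2 / (real N - 1)"
proof -
  define \<gamma> where "\<gamma> = c / (real N - 1)"
  have row: "(\<Sum>t\<in>{1..N} - {s}. (u_centered N a s t)\<^sup>2) =
     (\<Sum>t\<in>{1..N} - {s}. (offdiag_centered s t)\<^sup>2) + c\<^sup>2 / (real N - 1)"
    if s: "s \<in> {1..N}" for s
  proof -
    have "(\<Sum>t\<in>{1..N} - {s}. (u_centered N a s t)\<^sup>2) =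
      (\<Sum>t\<in>{1..N} - {s}. (offdiag_centered s t)\<^sup>2 - 2 * \<gamma> * offdiag_centered s t + \<gamma>\<^sup>2)"
      unfolding offdiag_centered_def \<gamma>_def
      by (intro sum.cong refl) (simp add: power2_eq_square algebra_simps)
    also have "\<dots> = (\<Sum>t\<in>{1..N} - {s}. (offdiag_centered s t)\<^sup>2)
        - 2 * \<gamma> * (\<Sum>t\<in>{1..N} - {s}. offdiag_centered s t) + (real N - 1) * \<gamma>\<^sup>2"
      using s by (simp add: sum.distrib sum_subtractf sum_distrib_left of_nat_diff)
    also have "(real N - 1) * \<gamma>\<^sup>2 = c\<^sup>2 / (real N - 1)"
      using size by (simp add: \<gamma>_def power2_eq_square)
    finally show ?thesis
      using sum_offdiag_centered[OF s] by simp
  qed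
  show ?thesis
    by (subst sum.cong[OF refl row]) (auto simp: sum.distrib)
qed

text \<open>
  Up to normalisation an entry of the centred array is the average of all contrasts through its
  two indices; this transfers bounds from contrasts to the variance estimator.
\<close>

lemma sum_quad_eq_offdiag_centered:
  assumes st: "s \<in> {1..N}" "t \<in> {1..N}" "s \<noteq> t"
  defines "J \<equiv> {1..N} - {s, t}"
  shows "(\<Sum>i\<in>J. \<Sum>j\<in>J - {i}. quad a s t i j) =
    (real N - 1) * (real N - 2) * offdiag_centered s t"
proof -
  have N: "real N - 1 \<noteq> 0" "real N - 2 \<noteq> 0" using size by auto
  have sumJ: "(\<Sum>i\<in>J. f i) = (\<Sum>i=1..N. f i) - f s - f t" for f :: "nat \<Rightarrow> real"
  proof -
    have "J = {1..N} - {s} - {t}" by (auto simp: J_def)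
    then show ?thesis using st by (simp add: sum_diff1)
  qed
  have sumJi: "(\<Sum>j\<in>J - {i}. f j) = (\<Sum>i=1..N. f i) - f s - f t - f i"
    if "i \<in> J" for f :: "nat \<Rightarrow> real" and i
    using that sumJ[of f] by (simp add: sum_diff1 J_def)
  have finJ: "finite J" by (simp add: J_def)
  have cardJ: "real (card J) = real N - 2"
    using sumJ[of "\<lambda>_. 1"] by simp
  have inner: "(\<Sum>j\<in>J - {i}. quad a s t i j) =
      (real N - 2) * a s t + row i - (real N - 2) * a s i - row t" if i: "i \<in> J" for i
  proof -
    have iN: "i \<in> {1..N}" using i by (auto simp: J_def)
    have "(\<Sum>j\<in>J - {i}. quad a s t i j) =
      (\<Sum>j\<in>J - {i}. a s t - a s i) + (\<Sum>j\<in>J - {i}. a i j) - (\<Sum>j\<in>J - {i}. a t j)"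
      unfolding quad_def by (simp only: sum.distrib sum_subtractf)
    also have "(\<Sum>j\<in>J - {i}. a s t - a s i) = (real N - 3) * (a s t - a s i)"
      using sumJi[OF i, of "\<lambda>_. a s t - a s i"] by (simp add: algebra_simps)
    also have "(\<Sum>j\<in>J - {i}. a i j) = row i - a s i - a t i - c"
      using sumJi[OF i, of "a i"] sym[OF iN st(1)] sym[OF iN st(2)] diag[OF iN] by (simp add: row_def)
    also have "(\<Sum>j\<in>J - {i}. a t j) = row t - a s t - c - a t i"
      using sumJi[OF i, of "a t"] sym[OF st(1,2)] diag[OF st(2)] by (simp add: row_def)
    finally show ?thesis by (simp add: algebra_simps)
  qed
  have rJ: "(\<Sum>i\<in>J. row i) = total - row s - row t"
    using sumJ[of row] by (simp add: total_def)
  have asJ: "(\<Sum>i\<in>J. a s i) = row s - c - a s t"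
    using sumJ[of "a s"] diag[OF st(1)] by (simp add: row_def)
  have "(\<Sum>i\<in>J. \<Sum>j\<in>J - {i}. quad a s t i j) =
      (\<Sum>i\<in>J. (real N - 2) * a s t + row i - (real N - 2) * a s i - row t)"
    using inner by (rule sum.cong[OF refl])
  also have "\<dots> = (real N - 2) * ((real N - 2) * a s t) + (total - row s - row t)
      - (real N - 2) * (row s - c - a s t) - (real N - 2) * row t"
    using rJ asJ cardJ by (simp add: sum.distrib sum_subtractf flip: sum_distrib_left)
  also have "\<dots> = (real N - 1) * (real N - 2) * offdiag_centered s t"
    unfolding offdiag_centered_eq[OF st(1,2)] using N by (simp add: divide_simps) (simp add: algebra_simps)
  finally show ?thesis .
qed

lemma quad_eq_offdiag_centered:
  assumes "s \<in> {1..N}" "t \<in> {1..N}" "i \<in> {1..N}" "j \<in> {1..N}"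
  shows "quad a s t i j = quad offdiag_centered s t i j"
  unfolding quad_def using assms by (simp add: offdiag_centered_eq)

text \<open>
  The square of an average is at most the average of the squares. The factor on the left is the
  number of contrasts through \<open>s\<close> and \<open>t\<close>.
\<close>

lemma offdiag_centered_square_le:
  assumes st: "s \<in> {1..N}" "t \<in> {1..N}" "s \<noteq> t"
  defines "J \<equiv> {1..N} - {s, t}"
  shows "(real N - 2) * (real N - 3) * (offdiag_centered s t)\<^sup>2
    \<le> (\<Sum>i\<in>J. \<Sum>j\<in>J - {i}. (quad a s t i j)\<^sup>2)"
proof -
  define P where "P = Sigma J (\<lambda>i. J - {i})"
  have finJ: "finite J" by (simp add: J_def)
  have cJ: "card J = N - 2"
    using st by (simp add: J_def card_Diff_subset)
  have cP: "real (card P) = (real N - 2) * (real N - 3)"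
    using cJ finJ size by (simp add: P_def card_SigmaI of_nat_diff)
  have "((real N - 1) * (real N - 2) * offdiag_centered s t)\<^sup>2 = (\<Sum>(i, j)\<in>P. quad a s t i j)\<^sup>2"
    unfolding sum_quad_eq_offdiag_centered[OF st, symmetric] P_def J_def[symmetric]
    using finJ by (simp add: sum.Sigma)
  also have "\<dots> \<le> (\<Sum>q\<in>P. (case q of (i, j) \<Rightarrow> quad a s t i j)\<^sup>2) * card P"
    by (rule sum_squared_le_sum_of_squares)
  also have "(\<Sum>q\<in>P. (case q of (i, j) \<Rightarrow> quad a s t i j)\<^sup>2) =
     (\<Sum>i\<in>J. \<Sum>j\<in>J - {i}. (quad a s t i j)\<^sup>2)" (is "_ = ?R")
    using finJ by (simp add: P_def sum.Sigma split_beta)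
  finally have *: "((real N - 1) * (real N - 2) * offdiag_centered s t)\<^sup>2 \<le> ?R * ((real N - 2) * (real N - 3))"
    using cP by simp
  have pos: "(real N - 2) * (real N - 3) > 0" using size by simp
  have "((real N - 2) * (real N - 3))\<^sup>2 \<le> ((real N - 1) * (real N - 2))\<^sup>2"
    using size by (intro power_mono) (auto intro: mult_mono)
  then have "((real N - 2) * (real N - 3))\<^sup>2 * (offdiag_centered s t)\<^sup>2 \<le> ?R * ((real N - 2) * (real N - 3))"
    using * by (smt (verit, best) mult_right_mono power_mult_distrib zero_le_power2)
  then have "((real N - 2) * (real N - 3)) * (((real N - 2) * (real N - 3)) * (offdiag_centered s t)\<^sup>2)
     \<le> ((real N - 2) * (real N - 3)) * ?R"
    by (simp add: power2_eq_square algebra_simps)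
  then show ?thesis
    using pos mult_le_cancel_left_pos by blast
qed

end

section \<open>Moment inequalities\<close>

lemma powr_abs_sum_le:
  fixes f :: "'i \<Rightarrow> real"
  assumes "0 \<le> q" and fin: "finite I"
  shows "\<bar>\<Sum>i\<in>I. f i\<bar> powr q \<le> real (card I) powr q * (\<Sum>i\<in>I. \<bar>f i\<bar> powr q)"
proof (cases "I = {}")
  case False
  have "Max ((\<lambda>i. \<bar>f i\<bar>) ` I) \<in> (\<lambda>i. \<bar>f i\<bar>) ` I" using fin False by (intro Max_in) simp_all
  then obtain j where max: "Max ((\<lambda>i. \<bar>f i\<bar>) ` I) = \<bar>f j\<bar>" and j: "j \<in> I"
    by (rule imageE)
  have le: "\<bar>f i\<bar> \<le> \<bar>f j\<bar>" if "i \<in> I" for i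
    unfolding max[symmetric] using fin that by (intro Max_ge) simp_all
  have "\<bar>\<Sum>i\<in>I. f i\<bar> \<le> (\<Sum>i\<in>I. \<bar>f j\<bar>)"
    by (intro order_trans[OF sum_abs] sum_mono le)
  then have "\<bar>\<Sum>i\<in>I. f i\<bar> powr q \<le> (real (card I) * \<bar>f j\<bar>) powr q"
    using assms by (intro powr_mono2) simp_all
  also have "\<dots> = real (card I) powr q * \<bar>f j\<bar> powr q" by (simp add: powr_mult)
  also have "\<dots> \<le> real (card I) powr q * (\<Sum>i\<in>I. \<bar>f i\<bar> powr q)"
    using j fin by (intro mult_left_mono member_le_sum) simp_all
  finally show ?thesis .
qed simp

context prob_space
begin

lemma integrable_lower_power:
  fixes g :: "'a \<Rightarrow> real"
  assumes g[measurable]: "g \<in> borel_measurable M" and int: "integrable M (\<lambda>x. g x ^ 4)"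
    and q: "0 \<le> q" "q \<le> 4"
  shows "integrable M (\<lambda>x. \<bar>g x\<bar> powr q)"
proof (rule Bochner_Integration.integrable_bound)
  show "integrable M (\<lambda>x. 1 + g x ^ 4)" using int by simp
  have "\<bar>y\<bar> powr q \<le> 1 + y ^ 4" for y :: real
  proof (cases "\<bar>y\<bar> \<le> 1")
    case True
    then have "\<bar>y\<bar> powr q \<le> 1" using q powr_le1 by auto
    then show ?thesis by (smt (verit) zero_le_even_power even_numeral)
  next
    case False
    then have "\<bar>y\<bar> powr q \<le> \<bar>y\<bar> powr 4" using q by (intro powr_mono) auto
    also have "\<dots> = y ^ 4" using False by (simp add: powr_numeral)
    finally show ?thesis by simp
  qed
  then show "AE x in M. norm (\<bar>g x\<bar> powr q) \<le> norm (1 + g x ^ 4)" by simp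
qed measurable

lemma integrable_lower_square:
  fixes g :: "'a \<Rightarrow> real"
  assumes "g \<in> borel_measurable M" and "integrable M (\<lambda>x. g x ^ 4)"
  shows "integrable M (\<lambda>x. (g x)\<^sup>2)"
proof -
  have "\<bar>y\<bar> powr 2 = y\<^sup>2" for y :: real
    by (cases "y = 0") (auto simp: powr_numeral)
  then show ?thesis using integrable_lower_power[OF assms, of 2] by simp
qed

lemma square_integrable_imp_integrable_mult:
  fixes f g :: "'a \<Rightarrow> real"
  assumes [measurable]: "f \<in> borel_measurable M" "g \<in> borel_measurable M"
    and "integrable M (\<lambda>x. (f x)\<^sup>2)" "integrable M (\<lambda>x. (g x)\<^sup>2)"
  shows "integrable M (\<lambda>x. f x * g x)"
proof (rule Bochner_Integration.integrable_bound)
  show "integrable M (\<lambda>x. (f x)\<^sup>2 + (g x)\<^sup>2)" using assms by simp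
  have "\<bar>u * v\<bar> \<le> u\<^sup>2 + v\<^sup>2" for u v :: real
  proof -
    have "2 * (\<bar>u\<bar> * \<bar>v\<bar>) \<le> u\<^sup>2 + v\<^sup>2"
      using sum_squares_bound[of "\<bar>u\<bar>" "\<bar>v\<bar>"] by simp
    moreover have "0 \<le> \<bar>u\<bar> * \<bar>v\<bar>" by simp
    ultimately show ?thesis unfolding abs_mult by linarith
  qed
  then show "AE x in M. norm (f x * g x) \<le> norm ((f x)\<^sup>2 + (g x)\<^sup>2)" by simp
qed measurable

lemma square_integrable_sum:
  fixes f g :: "'a \<Rightarrow> real"
  assumes [measurable]: "f \<in> borel_measurable M" "g \<in> borel_measurable M"
    and "integrable M (\<lambda>x. (f x)\<^sup>2)" "integrable M (\<lambda>x. (g x)\<^sup>2)"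
  shows "integrable M (\<lambda>x. (f x + g x)\<^sup>2)" "integrable M (\<lambda>x. (f x - g x)\<^sup>2)"
  using assms square_integrable_imp_integrable_mult[OF assms]
  by (auto simp: power2_sum power2_diff mult.assoc)

text \<open>
  Truncation of \<open>g\<^sup>2\<close> at \<open>level\<close>: below the level, \<open>g\<^sup>2\<close> costs at most
  \<open>level\<close> and only where \<open>g\<close> is nonzero; above it, \<open>g\<^sup>2\<close> is controlled by the higher
  moment. Read backwards, this is a lower bound for the probability of a nonzero value.
\<close>

lemma second_moment_le_prob_nonzero:
  fixes g :: "'a \<Rightarrow> real"
  assumes g[measurable]: "g \<in> borel_measurable M"
    and int: "integrable M (\<lambda>x. (g x)\<^sup>2)" "integrable M (\<lambda>x. \<bar>g x\<bar> powr (2 + 2 * \<tau>))"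
    and pos: "0 < \<tau>" "0 < level"
  shows "(\<integral>x. (g x)\<^sup>2 \<partial>M) \<le> level * \<P>(x in M. g x \<noteq> 0) + level powr (- \<tau>) * (\<integral>x. \<bar>g x\<bar> powr (2 + 2 * \<tau>) \<partial>M)"
proof -
  have pointwise: "y\<^sup>2 \<le> level * of_bool (y \<noteq> 0) + level powr (- \<tau>) * \<bar>y\<bar> powr (2 + 2 * \<tau>)" for y :: real
  proof (cases "y\<^sup>2 \<le> level \<or> y = 0")
    case True
    then show ?thesis by (auto simp: add_increasing2)
  next
    case False
    then have y: "level < y\<^sup>2" "0 < \<bar>y\<bar>" by auto
    have p: "\<bar>y\<bar> powr (2 + 2 * \<tau>) = y\<^sup>2 * (y\<^sup>2) powr \<tau>"
      using y(2) by (simp add: powr_add powr_powr[symmetric] powr_numeral)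
    have "1 \<le> level powr (- \<tau>) * (y\<^sup>2) powr \<tau>"
      using y(1) pos powr_mono2[of \<tau> level "y\<^sup>2"] by (simp add: powr_minus field_simps)
    then have "y\<^sup>2 * 1 \<le> y\<^sup>2 * (level powr (- \<tau>) * (y\<^sup>2) powr \<tau>)"
      by (rule mult_left_mono) simp
    then show ?thesis using p pos by (simp add: mult_ac add_increasing)
  qed
  have ev: "{x \<in> space M. g x \<noteq> 0} \<in> events" by measurable
  have ind: "(\<integral>x. of_bool (g x \<noteq> 0) \<partial>M) = \<P>(x in M. g x \<noteq> 0)"
    and ind_int: "integrable M (\<lambda>x. of_bool (g x \<noteq> 0) :: real)"
  proof -
    have *: "(of_bool (g x \<noteq> 0) :: real) = indicator {x \<in> space M. g x \<noteq> 0} x" if "x \<in> space M" for x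
      using that by (simp add: indicator_def)
    show "(\<integral>x. of_bool (g x \<noteq> 0) \<partial>M) = \<P>(x in M. g x \<noteq> 0)"
      using ev by (subst Bochner_Integration.integral_cong[OF refl *]) auto
    show "integrable M (\<lambda>x. of_bool (g x \<noteq> 0) :: real)"
      using ev by (subst Bochner_Integration.integrable_cong[OF refl *])
        (auto intro!: integrable_real_indicator simp: emeasure_eq_measure)
  qed
  have "(\<integral>x. (g x)\<^sup>2 \<partial>M) \<le>
    (\<integral>x. level * of_bool (g x \<noteq> 0) + level powr (- \<tau>) * \<bar>g x\<bar> powr (2 + 2 * \<tau>) \<partial>M)"
    using int ind_int pointwise by (intro integral_mono) auto
  then show ?thesis using int ind_int ind by simp
qed

text \<open>
  In the expansion of the square only the pairs related by \<open>R\<close> contribute, and each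
  contributes at most \<open>v\<close>. For a U-statistic, \<open>R\<close> relates terms with a common
  observation.
\<close>

lemma expectation_square_sum_le:
  fixes f :: "'q \<Rightarrow> 'a \<Rightarrow> real"
  assumes fin: "finite Q" and f[measurable]: "\<And>q. q \<in> Q \<Longrightarrow> f q \<in> borel_measurable M"
    and int: "\<And>q. q \<in> Q \<Longrightarrow> integrable M (\<lambda>x. (f q x)\<^sup>2)"
    and var: "\<And>q. q \<in> Q \<Longrightarrow> (\<integral>x. (f q x)\<^sup>2 \<partial>M) \<le> v"
    and uncorrelated: "\<And>q r. \<lbrakk>q \<in> Q; r \<in> Q; \<not> R q r\<rbrakk> \<Longrightarrow> (\<integral>x. f q x * f r x \<partial>M) = 0"
    and card: "\<And>q. q \<in> Q \<Longrightarrow> real (card {r \<in> Q. R q r}) \<le> c" and v: "0 \<le> v"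
  shows "integrable M (\<lambda>x. (\<Sum>q\<in>Q. f q x)\<^sup>2)"
    and "(\<integral>x. (\<Sum>q\<in>Q. f q x)\<^sup>2 \<partial>M) \<le> real (card Q) * c * v"
proof -
  have sq: "(\<Sum>q\<in>Q. f q x)\<^sup>2 = (\<Sum>q\<in>Q. \<Sum>r\<in>Q. f q x * f r x)" for x
    by (simp add: power2_eq_square sum_product)
  have prod_int: "integrable M (\<lambda>x. f q x * f r x)" if "q \<in> Q" "r \<in> Q" for q r
    using that int by (intro square_integrable_imp_integrable_mult f) auto
  show "integrable M (\<lambda>x. (\<Sum>q\<in>Q. f q x)\<^sup>2)"
    unfolding sq using prod_int by (intro Bochner_Integration.integrable_sum) auto
  have cov: "(\<integral>x. f q x * f r x \<partial>M) \<le> (if R q r then v else 0)" if qr: "q \<in> Q" "r \<in> Q" for q r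
  proof (cases "R q r")
    case True
    have "(\<integral>x. f q x * f r x \<partial>M) \<le> (\<integral>x. ((f q x)\<^sup>2 + (f r x)\<^sup>2) / 2 \<partial>M)"
    proof (rule integral_mono)
      show "f q x * f r x \<le> ((f q x)\<^sup>2 + (f r x)\<^sup>2) / 2" for x
        using sum_squares_bound[of "f q x" "f r x"] by simp
    qed (use qr prod_int int in auto)
    also have "\<dots> \<le> v"
      using int[OF qr(1)] int[OF qr(2)] var[OF qr(1)] var[OF qr(2)] by simp
    finally show ?thesis using True by simp
  qed (use uncorrelated qr in simp)
  have "(\<integral>x. (\<Sum>q\<in>Q. f q x)\<^sup>2 \<partial>M) = (\<Sum>q\<in>Q. \<Sum>r\<in>Q. \<integral>x. f q x * f r x \<partial>M)"
    unfolding sq by (intro trans[OF Bochner_Integration.integral_sum] sum.cong refl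
        Bochner_Integration.integrable_sum prod_int)
  also have "\<dots> \<le> (\<Sum>q\<in>Q. \<Sum>r\<in>Q. if R q r then v else 0)"
    by (intro sum_mono cov)
  also have "\<dots> = (\<Sum>q\<in>Q. real (card {r \<in> Q. R q r}) * v)"
    using fin by (simp add: sum.If_cases Int_def)
  also have "\<dots> \<le> (\<Sum>q\<in>Q. c * v)"
    using card v by (intro sum_mono mult_right_mono) auto
  finally show "(\<integral>x. (\<Sum>q\<in>Q. f q x)\<^sup>2 \<partial>M) \<le> real (card Q) * c * v"
    by simp
qed

end

section \<open>Joint laws of independent variables\<close>

context prob_space
begin

lemma indep_var_of_disjoint:
  assumes "indep_vars (\<lambda>_. S) U I" "A \<inter> B = {}" "A \<subseteq> I" "B \<subseteq> I"
    and "f \<in> measurable (PiM A (\<lambda>_. S)) T" "g \<in> measurable (PiM B (\<lambda>_. S)) T'"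
  shows "indep_var T (\<lambda>\<omega>. f (\<lambda>i\<in>A. U i \<omega>)) T' (\<lambda>\<omega>. g (\<lambda>i\<in>B. U i \<omega>))"
  using indep_var_compose[OF indep_var_restrict[OF assms(1-4)] assms(5,6)] by (simp add: comp_def)

text \<open>
  The predicate \<open>indep_var\<close> relates variables with values in one type, so variables of
  different types are handled through the restricted families on which they depend.
\<close>

lemma distr_disjoint_pair:
  assumes ind: "indep_vars (\<lambda>_. S) U I" and AB: "A \<inter> B = {}" "A \<subseteq> I" "B \<subseteq> I"
    and f[measurable]: "f \<in> measurable (PiM A (\<lambda>_. S)) T"
    and g[measurable]: "g \<in> measurable (PiM B (\<lambda>_. S)) T'"
  shows "distr M (T \<Otimes>\<^sub>M T') (\<lambda>\<omega>. (f (\<lambda>i\<in>A. U i \<omega>), g (\<lambda>i\<in>B. U i \<omega>))) =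
    distr M T (\<lambda>\<omega>. f (\<lambda>i\<in>A. U i \<omega>)) \<Otimes>\<^sub>M distr M T' (\<lambda>\<omega>. g (\<lambda>i\<in>B. U i \<omega>))"
proof -
  let ?a = "\<lambda>\<omega>. \<lambda>i\<in>A. U i \<omega>" and ?b = "\<lambda>\<omega>. \<lambda>i\<in>B. U i \<omega>"
  let ?A = "PiM A (\<lambda>_. S)" and ?B = "PiM B (\<lambda>_. S)"
  have iv: "indep_var ?A ?a ?B ?b"
    by (rule indep_var_restrict[OF ind AB])
  then have [measurable]: "?a \<in> measurable M ?A" "?b \<in> measurable M ?B"
    and eq: "distr M ?A ?a \<Otimes>\<^sub>M distr M ?B ?b = distr M (?A \<Otimes>\<^sub>M ?B) (\<lambda>\<omega>. (?a \<omega>, ?b \<omega>))"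
    unfolding indep_var_distribution_eq by auto
  have psf: "prob_space (distr (distr M ?B ?b) T' g)"
    by (intro prob_space.prob_space_distr prob_space_distr) measurable
  have "distr M T (\<lambda>\<omega>. f (?a \<omega>)) \<Otimes>\<^sub>M distr M T' (\<lambda>\<omega>. g (?b \<omega>)) =
    distr (distr M ?A ?a) T f \<Otimes>\<^sub>M distr (distr M ?B ?b) T' g"
    by (simp add: distr_distr comp_def)
  also have "\<dots> = distr (distr M ?A ?a \<Otimes>\<^sub>M distr M ?B ?b) (T \<Otimes>\<^sub>M T') (\<lambda>(x, y). (f x, g y))"
    using psf by (intro pair_measure_distr)
      (auto simp: prob_space_def finite_measure_def)
  also have "\<dots> = distr M (T \<Otimes>\<^sub>M T') (\<lambda>\<omega>. (f (?a \<omega>), g (?b \<omega>)))"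
    unfolding eq by (subst distr_distr) (auto simp: comp_def)
  finally show ?thesis by simp
qed

lemma distr_two_indep:
  assumes ind: "indep_vars (\<lambda>_. S) U I" and ab: "a \<in> I" "b \<in> I" "a \<noteq> b"
  shows "distr M (S \<Otimes>\<^sub>M S) (\<lambda>\<omega>. (U a \<omega>, U b \<omega>)) = distr M S (U a) \<Otimes>\<^sub>M distr M S (U b)"
proof -
  show ?thesis
    using ab distr_disjoint_pair[OF ind, of "{a}" "{b}" "\<lambda>x. x a" S "\<lambda>x. x b" S] by simp
qed

lemma distr_four_indep:
  assumes ind: "indep_vars (\<lambda>_. S) U I" and I: "{a, b, c, d} \<subseteq> I" and dist: "distinct [a, b, c, d]"
  shows "distr M (S \<Otimes>\<^sub>M (S \<Otimes>\<^sub>M (S \<Otimes>\<^sub>M S))) (\<lambda>\<omega>. (U a \<omega>, U b \<omega>, U c \<omega>, U d \<omega>)) =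
    distr M S (U a) \<Otimes>\<^sub>M (distr M S (U b) \<Otimes>\<^sub>M (distr M S (U c) \<Otimes>\<^sub>M distr M S (U d)))"
proof -
  have "distr M (S \<Otimes>\<^sub>M (S \<Otimes>\<^sub>M (S \<Otimes>\<^sub>M S))) (\<lambda>\<omega>. (U a \<omega>, U b \<omega>, U c \<omega>, U d \<omega>)) =
    distr M S (U a) \<Otimes>\<^sub>M distr M (S \<Otimes>\<^sub>M (S \<Otimes>\<^sub>M S)) (\<lambda>\<omega>. (U b \<omega>, U c \<omega>, U d \<omega>))"
    using I dist distr_disjoint_pair[OF ind, of "{a}" "{b, c, d}" "\<lambda>x. x a" S
      "\<lambda>x. (x b, x c, x d)" "S \<Otimes>\<^sub>M (S \<Otimes>\<^sub>M S)"] by simp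
  moreover have "distr M (S \<Otimes>\<^sub>M (S \<Otimes>\<^sub>M S)) (\<lambda>\<omega>. (U b \<omega>, U c \<omega>, U d \<omega>)) =
    distr M S (U b) \<Otimes>\<^sub>M distr M (S \<Otimes>\<^sub>M S) (\<lambda>\<omega>. (U c \<omega>, U d \<omega>))"
    using I dist distr_disjoint_pair[OF ind, of "{b}" "{c, d}" "\<lambda>x. x b" S
      "\<lambda>x. (x c, x d)" "S \<Otimes>\<^sub>M S"] by simp
  ultimately show ?thesis
    using I dist distr_two_indep[OF ind, of c d] by simp
qed

end

text \<open>
  By Tonelli's theorem, domination of measures passes to products, one coordinate at a time.
\<close>

lemma nn_integral_pair_le:
  assumes "prob_space P1" "prob_space P2" "prob_space Q1" "prob_space Q2"
    and sets: "sets P1 = sets S1" "sets Q1 = sets S1" "sets P2 = sets S2" "sets Q2 = sets S2"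
    and le1: "\<And>f. f \<in> borel_measurable S1 \<Longrightarrow> (\<integral>\<^sup>+x. f x \<partial>P1) \<le> c1 * (\<integral>\<^sup>+x. f x \<partial>Q1)"
    and le2: "\<And>f. f \<in> borel_measurable S2 \<Longrightarrow> (\<integral>\<^sup>+x. f x \<partial>P2) \<le> c2 * (\<integral>\<^sup>+x. f x \<partial>Q2)"
    and f[measurable]: "f \<in> borel_measurable (S1 \<Otimes>\<^sub>M S2)"
  shows "(\<integral>\<^sup>+x. f x \<partial>(P1 \<Otimes>\<^sub>M P2)) \<le> c1 * c2 * (\<integral>\<^sup>+x. f x \<partial>(Q1 \<Otimes>\<^sub>M Q2))"
proof -
  interpret P1: prob_space P1 by fact
  interpret P2: prob_space P2 by fact
  interpret Q1: prob_space Q1 by fact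
  interpret Q2: prob_space Q2 by fact
  note [measurable_cong] = sets
  have "(\<integral>\<^sup>+x. f x \<partial>(P1 \<Otimes>\<^sub>M P2)) = (\<integral>\<^sup>+x. \<integral>\<^sup>+y. f (x, y) \<partial>P2 \<partial>P1)"
    by (subst P2.nn_integral_fst) auto
  also have "\<dots> \<le> c1 * (\<integral>\<^sup>+x. \<integral>\<^sup>+y. f (x, y) \<partial>P2 \<partial>Q1)"
    by (intro le1) measurable
  also have "\<dots> \<le> c1 * (\<integral>\<^sup>+x. c2 * (\<integral>\<^sup>+y. f (x, y) \<partial>Q2) \<partial>Q1)"
    using sets_eq_imp_space_eq[OF sets(2)] by (intro mult_left_mono nn_integral_mono le2) auto
  also have "\<dots> = c1 * c2 * (\<integral>\<^sup>+x. \<integral>\<^sup>+y. f (x, y) \<partial>Q2 \<partial>Q1)"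
    by (subst nn_integral_cmult) (auto simp: mult.assoc)
  also have "\<dots> = c1 * c2 * (\<integral>\<^sup>+x. f x \<partial>(Q1 \<Otimes>\<^sub>M Q2))"
    by (subst Q2.nn_integral_fst) auto
  finally show ?thesis .
qed

text \<open>
  If an integral is always bounded by the integral against some member of a family (the member
  may depend on the integrand), the same holds for products: first choose the member for the
  first coordinate, then apply the hypothesis to the function of the second coordinate that
  results from integrating out the first.
\<close>

lemma nn_integral_pair_le_some:
  assumes "prob_space Q1" "prob_space Q2" "\<And>b. prob_space (P1 b)"
    and sets: "\<And>b. sets (P1 b) = sets S1" "sets Q1 = sets S1" "\<And>j. sets (P2 j) = sets S2" "sets Q2 = sets S2"
    and "\<And>j. prob_space (P2 j)"
    and le1: "\<And>f. f \<in> borel_measurable S1 \<Longrightarrow> \<exists>b. (\<integral>\<^sup>+x. f x \<partial>Q1) \<le> (\<integral>\<^sup>+x. f x \<partial>P1 b)"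
    and le2: "\<And>f. f \<in> borel_measurable S2 \<Longrightarrow> \<exists>j. (\<integral>\<^sup>+x. f x \<partial>Q2) \<le> (\<integral>\<^sup>+x. f x \<partial>P2 j)"
    and f[measurable]: "f \<in> borel_measurable (S1 \<Otimes>\<^sub>M S2)"
  shows "\<exists>b j. (\<integral>\<^sup>+x. f x \<partial>(Q1 \<Otimes>\<^sub>M Q2)) \<le> (\<integral>\<^sup>+x. f x \<partial>(P1 b \<Otimes>\<^sub>M P2 j))"
proof -
  interpret Q1: prob_space Q1 by fact
  interpret Q2: prob_space Q2 by fact
  note [measurable_cong] = sets
  have m: "(\<lambda>x. \<integral>\<^sup>+y. f (x, y) \<partial>Q2) \<in> borel_measurable S1" by measurable
  obtain b where b: "(\<integral>\<^sup>+x. \<integral>\<^sup>+y. f (x, y) \<partial>Q2 \<partial>Q1) \<le> (\<integral>\<^sup>+x. \<integral>\<^sup>+y. f (x, y) \<partial>Q2 \<partial>P1 b)"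
    using le1[OF m] by auto
  \<comment> \<open>Exchanging the order of integration prepares the choice for the second coordinate.\<close>
  interpret P1: prob_space "P1 b" by fact
  interpret PQ: pair_sigma_finite "P1 b" Q2 ..
  have m2: "(\<lambda>y. \<integral>\<^sup>+x. f (x, y) \<partial>P1 b) \<in> borel_measurable S2" by measurable
  obtain j where j: "(\<integral>\<^sup>+y. \<integral>\<^sup>+x. f (x, y) \<partial>P1 b \<partial>Q2) \<le> (\<integral>\<^sup>+y. \<integral>\<^sup>+x. f (x, y) \<partial>P1 b \<partial>P2 j)"
    using le2[OF m2] by auto
  interpret P2: prob_space "P2 j" by fact
  interpret PP: pair_sigma_finite "P1 b" "P2 j" ..
  have "(\<integral>\<^sup>+x. f x \<partial>(Q1 \<Otimes>\<^sub>M Q2)) \<le> (\<integral>\<^sup>+x. \<integral>\<^sup>+y. f (x, y) \<partial>Q2 \<partial>P1 b)"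
    using b by (subst Q2.nn_integral_fst[symmetric]) auto
  also have "\<dots> = (\<integral>\<^sup>+y. \<integral>\<^sup>+x. f (x, y) \<partial>P1 b \<partial>Q2)"
    by (rule PQ.Fubini[symmetric]) measurable
  also have "\<dots> \<le> (\<integral>\<^sup>+x. f x \<partial>(P1 b \<Otimes>\<^sub>M P2 j))"
    using j by (subst PP.nn_integral_snd[symmetric]) auto
  finally show ?thesis by blast
qed

section \<open>The pooled sample and the mixture\<close>

locale energy_model = two_sample M p \<rho> X Y Z
  for M :: "'a measure" and p :: nat and \<rho> :: real and X Y Z :: "nat \<Rightarrow> 'a \<Rightarrow> (nat \<Rightarrow> real)" +
  fixes k :: "(nat \<Rightarrow> real) \<Rightarrow> (nat \<Rightarrow> real) \<Rightarrow> real" and a0 :: real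
  assumes rho: "0 < \<rho>" "\<rho> < 1"
    and kernel_measurable: "case_prod k \<in> borel_measurable (euclid p \<Otimes>\<^sub>M euclid p)"
    and kernel_sym: "\<lbrakk>x \<in> space (euclid p); y \<in> space (euclid p)\<rbrakk> \<Longrightarrow> k x y = k y x"
    and kernel_diag: "x \<in> space (euclid p) \<Longrightarrow> k x x = a0"
    and fourth_moment: "integrable M (\<lambda>\<omega>. (k (Z 1 \<omega>) (Z 2 \<omega>)) ^ 4)"
begin

abbreviation S :: "(nat \<Rightarrow> real) measure" where "S \<equiv> euclid p"
abbreviation S4 :: "((nat \<Rightarrow> real) \<times> (nat \<Rightarrow> real) \<times> (nat \<Rightarrow> real) \<times> (nat \<Rightarrow> real)) measure" where
  "S4 \<equiv> S \<Otimes>\<^sub>M (S \<Otimes>\<^sub>M (S \<Otimes>\<^sub>M S))"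

text \<open>
  The two samples form one independent family indexed by the disjoint union; \<open>isl\<close> then tells
  from which of the two populations an observation comes.
\<close>

definition idx :: "(nat + nat) set" where "idx = {1..} <+> {1..}"

definition sample :: "nat + nat \<Rightarrow> 'a \<Rightarrow> (nat \<Rightarrow> real)" where "sample = case_sum X Y"

definition marg :: "bool \<Rightarrow> (nat \<Rightarrow> real) measure" where
  "marg b = distr M S (if b then X 1 else Y 1)"

definition mix :: "(nat \<Rightarrow> real) measure" where "mix = distr M S (Z 1)"

definition minority :: real where "minority = min \<rho> (1 - \<rho>)"

abbreviation V2 :: real where "V2 \<equiv> dvar2 M k Z"
abbreviation En :: real where "En \<equiv> energy_dist M k X Y"

lemma minority: "0 < minority" "minority \<le> \<rho>" "minority \<le> 1 - \<rho>"
  using rho by (auto simp: minority_def)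

lemma kernel_compose[measurable (raw)]:
  "\<lbrakk>f \<in> measurable A S; g \<in> measurable A S\<rbrakk> \<Longrightarrow> (\<lambda>x. k (f x) (g x)) \<in> borel_measurable A"
  using measurable_compose[OF measurable_Pair kernel_measurable, of f A g] by simp

lemma quad_compose[measurable (raw)]:
  "\<lbrakk>f1 \<in> measurable A S; f2 \<in> measurable A S; f3 \<in> measurable A S; f4 \<in> measurable A S\<rbrakk>
   \<Longrightarrow> (\<lambda>x. quad k (f1 x) (f2 x) (f3 x) (f4 x)) \<in> borel_measurable A"
  unfolding quad_def by (intro borel_measurable_diff borel_measurable_add kernel_compose)

lemma h_compose[measurable (raw)]:
  "\<lbrakk>f1 \<in> measurable A S; f2 \<in> measurable A S; f3 \<in> measurable A S; f4 \<in> measurable A S\<rbrakk>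
   \<Longrightarrow> (\<lambda>x. h_kernel k (f1 x) (f2 x) (f3 x) (f4 x)) \<in> borel_measurable A"
  unfolding h_kernel_def
  by (intro borel_measurable_diff borel_measurable_times borel_measurable_const borel_measurable_add
      kernel_compose)

lemma Inl_idx[simp]: "Inl i \<in> idx \<longleftrightarrow> 1 \<le> i" and Inr_idx[simp]: "Inr i \<in> idx \<longleftrightarrow> 1 \<le> i"
  by (auto simp: idx_def)

lemma indep_sample: "indep_vars (\<lambda>_. S) sample idx"
  using indep_XY by (simp add: sample_def idx_def)

lemma sample_measurable[measurable]: "a \<in> idx \<Longrightarrow> sample a \<in> measurable M S"
  using indep_sample by (auto simp: indep_vars_def)

lemma X_measurable[measurable]: "1 \<le> i \<Longrightarrow> X i \<in> measurable M S"
  using sample_measurable[of "Inl i"] by (simp add: sample_def)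

lemma Y_measurable[measurable]: "1 \<le> i \<Longrightarrow> Y i \<in> measurable M S"
  using sample_measurable[of "Inr i"] by (simp add: sample_def)

lemma Z_measurable[measurable]: "1 \<le> i \<Longrightarrow> Z i \<in> measurable M S"
  using indep_Z by (auto simp: indep_vars_def)

lemma sample_space: "\<lbrakk>a \<in> idx; \<omega> \<in> space M\<rbrakk> \<Longrightarrow> sample a \<omega> \<in> space S"
  using sample_measurable measurable_space by metis

lemma Z_space: "\<lbrakk>1 \<le> i; \<omega> \<in> space M\<rbrakk> \<Longrightarrow> Z i \<omega> \<in> space S"
  using Z_measurable measurable_space by metis

lemma distr_sample: "a \<in> idx \<Longrightarrow> distr M S (sample a) = marg (isl a)"
  using ident_X[of "projl a"] ident_Y[of "projr a"]
  by (cases a) (simp_all add: sample_def marg_def)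

lemma sets_marg[measurable_cong, simp]: "sets (marg b) = sets S"
  and space_marg[simp]: "space (marg b) = space S"
  by (simp_all add: marg_def)

lemma prob_space_marg: "prob_space (marg b)"
  unfolding marg_def by (intro prob_space_distr) simp

lemma sets_mix[measurable_cong, simp]: "sets mix = sets S"
  and space_mix[simp]: "space mix = space S"
  by (simp_all add: mix_def)

lemma prob_space_mix: "prob_space mix"
  unfolding mix_def by (intro prob_space_distr) simp

lemma emeasure_Z:
  assumes "1 \<le> i" and A: "A \<in> sets S"
  shows "emeasure (distr M S (Z i)) A =
    ennreal \<rho> * emeasure (marg True) A + ennreal (1 - \<rho>) * emeasure (marg False) A"
proof -
  have *: "emeasure (distr M S U) A = ennreal (\<P>(\<omega> in M. U \<omega> \<in> A))" if "U \<in> measurable M S" for U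
    using that A by (simp add: emeasure_distr emeasure_eq_measure vimage_def Int_def conj_commute)
  show ?thesis
    using rho mixture_Z[OF assms] * assms(1)
    by (simp add: marg_def * flip: ennreal_mult ennreal_plus)
qed

lemma distr_Z: "1 \<le> i \<Longrightarrow> distr M S (Z i) = mix"
  unfolding mix_def by (rule measure_eqI) (simp_all add: emeasure_Z)

text \<open>
  The mixture law is realised by drawing the label from a Bernoulli distribution and then an
  observation from the law with this label.
\<close>

lemma nn_integral_mix:
  assumes f: "f \<in> borel_measurable S"
  shows "(\<integral>\<^sup>+x. f x \<partial>mix) = ennreal \<rho> * (\<integral>\<^sup>+x. f x \<partial>marg True) + ennreal (1 - \<rho>) * (\<integral>\<^sup>+x. f x \<partial>marg False)"
proof -
  have marg_kernel: "marg \<in> measurable (measure_pmf (bernoulli_pmf \<rho>)) (subprob_algebra S)"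
    using prob_space_imp_subprob_space[OF prob_space_marg]
    by (auto simp: space_subprob_algebra)
  have bern: "(\<integral>\<^sup>+b. g b \<partial>bernoulli_pmf \<rho>) = ennreal \<rho> * g True + ennreal (1 - \<rho>) * g False" for g
    using rho by (subst nn_integral_bernoulli_pmf) (auto simp: mult.commute ennreal_minus)
  have "mix = measure_pmf (bernoulli_pmf \<rho>) \<bind> marg"
  proof (rule measure_eqI)
    show sets: "sets mix = sets (measure_pmf (bernoulli_pmf \<rho>) \<bind> marg)"
      by (subst sets_bind) auto
    fix A assume "A \<in> sets mix"
    then show "emeasure mix A = emeasure (measure_pmf (bernoulli_pmf \<rho>) \<bind> marg) A"
      by (simp add: emeasure_bind[OF _ marg_kernel] bern) (simp add: mix_def emeasure_Z)
  qed
  then show ?thesis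
    by (simp add: nn_integral_bind[OF f marg_kernel] bern)
qed

text \<open>
  Each population has weight at least \<open>minority\<close> in the mixture.
\<close>

lemma nn_integral_marg_le:
  assumes f: "f \<in> borel_measurable S"
  shows "(\<integral>\<^sup>+x. f x \<partial>marg b) \<le> ennreal (1 / minority) * (\<integral>\<^sup>+x. f x \<partial>mix)"
proof -
  let ?I = "\<integral>\<^sup>+x. f x \<partial>marg b"
  have "ennreal minority * ?I \<le> (\<integral>\<^sup>+x. f x \<partial>mix)"
  proof (cases b)
    case True
    then have "ennreal minority * ?I \<le> ennreal \<rho> * (\<integral>\<^sup>+x. f x \<partial>marg True)"
      using minority by (intro mult_mono ennreal_leI) auto
    then show ?thesis unfolding nn_integral_mix[OF f] by (simp add: add_increasing2)
  next
    case False
    then have "ennreal minority * ?I \<le> ennreal (1 - \<rho>) * (\<integral>\<^sup>+x. f x \<partial>marg False)"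
      using minority by (intro mult_mono ennreal_leI) auto
    then show ?thesis unfolding nn_integral_mix[OF f] by (simp add: add_increasing)
  qed
  then have "ennreal (1 / minority) * (ennreal minority * ?I) \<le> ennreal (1 / minority) * (\<integral>\<^sup>+x. f x \<partial>mix)"
    by (rule mult_left_mono) simp
  also have "ennreal (1 / minority) * (ennreal minority * ?I) = ?I"
    using minority by (simp add: mult.assoc[symmetric] flip: ennreal_mult)
  finally show ?thesis .
qed

lemma nn_integral_mix_le_some:
  assumes f: "f \<in> borel_measurable S"
  shows "\<exists>b. (\<integral>\<^sup>+x. f x \<partial>mix) \<le> (\<integral>\<^sup>+x. f x \<partial>marg b)"
proof -
  let ?I = "\<lambda>b. \<integral>\<^sup>+x. f x \<partial>marg b"
  obtain b where b: "\<And>c. ?I c \<le> ?I b"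
    by (cases "?I True \<le> ?I False") (metis (full_types) linear order_refl)+
  have "(\<integral>\<^sup>+x. f x \<partial>mix) \<le> ennreal \<rho> * ?I b + ennreal (1 - \<rho>) * ?I b"
    unfolding nn_integral_mix[OF f] using b by (intro add_mono mult_left_mono) auto
  also have "\<dots> = ?I b"
    using rho by (simp flip: distrib_right ennreal_plus)
  finally show ?thesis by blast
qed

definition marg4 :: "bool \<times> bool \<times> bool \<times> bool \<Rightarrow> _ measure" where
  "marg4 L = (case L of (b1, b2, b3, b4) \<Rightarrow> marg b1 \<Otimes>\<^sub>M (marg b2 \<Otimes>\<^sub>M (marg b3 \<Otimes>\<^sub>M marg b4)))"

definition mix4 where "mix4 = mix \<Otimes>\<^sub>M (mix \<Otimes>\<^sub>M (mix \<Otimes>\<^sub>M mix))"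

lemma nn_integral_mix4_le_some:
  assumes f: "f \<in> borel_measurable S4"
  shows "\<exists>L. (\<integral>\<^sup>+x. f x \<partial>mix4) \<le> (\<integral>\<^sup>+x. f x \<partial>marg4 L)"
proof -
  note P = prob_space_pair prob_space_marg prob_space_mix
  have 2: "\<exists>b c. (\<integral>\<^sup>+x. f x \<partial>(mix \<Otimes>\<^sub>M mix)) \<le> (\<integral>\<^sup>+x. f x \<partial>(marg b \<Otimes>\<^sub>M marg c))"
    if "f \<in> borel_measurable (S \<Otimes>\<^sub>M S)" for f
    by (rule nn_integral_pair_le_some[OF _ _ _ _ _ _ _ _ nn_integral_mix_le_some nn_integral_mix_le_some that])
      (auto intro: P)
  have 3: "\<exists>b c. (\<integral>\<^sup>+x. f x \<partial>(mix \<Otimes>\<^sub>M (mix \<Otimes>\<^sub>M mix))) \<le> (\<integral>\<^sup>+x. f x \<partial>(marg b \<Otimes>\<^sub>M (marg (fst c) \<Otimes>\<^sub>M marg (snd c))))"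
    if "f \<in> borel_measurable (S \<Otimes>\<^sub>M (S \<Otimes>\<^sub>M S))" for f
    by (rule nn_integral_pair_le_some[where ?P2.0 = "\<lambda>c. marg (fst c) \<Otimes>\<^sub>M marg (snd c)",
          OF _ _ _ _ _ _ _ _ nn_integral_mix_le_some _ that])
      (use 2 in \<open>auto intro!: P sets_pair_measure_cong\<close>)
  have "\<exists>b c. (\<integral>\<^sup>+x. f x \<partial>(mix \<Otimes>\<^sub>M (mix \<Otimes>\<^sub>M (mix \<Otimes>\<^sub>M mix)))) \<le>
     (\<integral>\<^sup>+x. f x \<partial>(marg b \<Otimes>\<^sub>M (marg (fst c) \<Otimes>\<^sub>M (marg (fst (snd c)) \<Otimes>\<^sub>M marg (snd (snd c))))))"
    by (rule nn_integral_pair_le_some[where ?P2.0 = "\<lambda>c. marg (fst c) \<Otimes>\<^sub>M (marg (fst (snd c)) \<Otimes>\<^sub>M marg (snd (snd c)))",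
          OF _ _ _ _ _ _ _ _ nn_integral_mix_le_some _ f])
      (use 3 in \<open>auto intro!: P sets_pair_measure_cong\<close>)
  then obtain b c where "(\<integral>\<^sup>+x. f x \<partial>mix4) \<le> (\<integral>\<^sup>+x. f x \<partial>marg4 (b, c))"
    unfolding mix4_def marg4_def by (force simp: case_prod_beta)
  then show ?thesis by blast
qed

lemma nn_integral_marg2_le:
  assumes f: "f \<in> borel_measurable (S \<Otimes>\<^sub>M S)"
  shows "(\<integral>\<^sup>+x. f x \<partial>(marg b \<Otimes>\<^sub>M marg c)) \<le> ennreal ((1 / minority)\<^sup>2) * (\<integral>\<^sup>+x. f x \<partial>(mix \<Otimes>\<^sub>M mix))"
proof -
  have "(\<integral>\<^sup>+x. f x \<partial>(marg b \<Otimes>\<^sub>M marg c)) \<le>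
      ennreal (1 / minority) * ennreal (1 / minority) * (\<integral>\<^sup>+x. f x \<partial>(mix \<Otimes>\<^sub>M mix))"
    by (rule nn_integral_pair_le[OF _ _ _ _ _ _ _ _ nn_integral_marg_le nn_integral_marg_le f])
      (auto intro: prob_space_marg prob_space_mix)
  then show ?thesis using minority by (simp add: power2_eq_square flip: ennreal_mult)
qed

lemma nn_integral_marg4_le:
  assumes f: "f \<in> borel_measurable S4"
  shows "(\<integral>\<^sup>+x. f x \<partial>marg4 L) \<le> ennreal ((1 / minority) ^ 4) * (\<integral>\<^sup>+x. f x \<partial>mix4)"
proof -
  note P = prob_space_pair prob_space_marg prob_space_mix
  obtain a b c d where L: "L = (a, b, c, d)" by (cases L) auto
  have 3: "(\<integral>\<^sup>+x. f x \<partial>(marg b \<Otimes>\<^sub>M (marg c \<Otimes>\<^sub>M marg d))) \<le>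
      ennreal (1 / minority) * ennreal ((1 / minority)\<^sup>2) * (\<integral>\<^sup>+x. f x \<partial>(mix \<Otimes>\<^sub>M (mix \<Otimes>\<^sub>M mix)))"
    if "f \<in> borel_measurable (S \<Otimes>\<^sub>M (S \<Otimes>\<^sub>M S))" for f
    by (rule nn_integral_pair_le[OF _ _ _ _ _ _ _ _ nn_integral_marg_le nn_integral_marg2_le that])
      (auto intro!: P sets_pair_measure_cong)
  have "(\<integral>\<^sup>+x. f x \<partial>marg4 L) \<le>
      ennreal (1 / minority) * (ennreal (1 / minority) * ennreal ((1 / minority)\<^sup>2)) * (\<integral>\<^sup>+x. f x \<partial>mix4)"
    unfolding L marg4_def mix4_def prod.case
    by (rule nn_integral_pair_le[OF _ _ _ _ _ _ _ _ nn_integral_marg_le 3 f])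
      (auto intro!: P sets_pair_measure_cong)
  then show ?thesis using minority
    by (simp add: power2_eq_square power4_eq_xxxx mult.assoc flip: ennreal_mult)
qed

lemma distr_sample_pair:
  assumes "a \<in> idx" "b \<in> idx" "a \<noteq> b"
  shows "distr M (S \<Otimes>\<^sub>M S) (\<lambda>\<omega>. (sample a \<omega>, sample b \<omega>)) = marg (isl a) \<Otimes>\<^sub>M marg (isl b)"
  using distr_two_indep[OF indep_sample assms] distr_sample assms by simp

lemma distr_Z_pair:
  assumes "1 \<le> a" "1 \<le> b" "a \<noteq> b"
  shows "distr M (S \<Otimes>\<^sub>M S) (\<lambda>\<omega>. (Z a \<omega>, Z b \<omega>)) = mix \<Otimes>\<^sub>M mix"
  using distr_two_indep[OF indep_Z, of a b] distr_Z assms by simp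

lemma distr_sample_four:
  assumes "{a, b, c, d} \<subseteq> idx" "distinct [a, b, c, d]"
  shows "distr M S4 (\<lambda>\<omega>. (sample a \<omega>, sample b \<omega>, sample c \<omega>, sample d \<omega>)) =
    marg4 (isl a, isl b, isl c, isl d)"
  using distr_four_indep[OF indep_sample assms] distr_sample assms(1) by (simp add: marg4_def)

lemma distr_Z_four:
  assumes "{a, b, c, d} \<subseteq> {1..}" "distinct [a, b, c, d]"
  shows "distr M S4 (\<lambda>\<omega>. (Z a \<omega>, Z b \<omega>, Z c \<omega>, Z d \<omega>)) = mix4"
  using distr_four_indep[OF indep_Z assms] distr_Z assms(1) by (simp add: mix4_def)

lemma integrable_kernel_Z_4:
  assumes "1 \<le> a" "1 \<le> b" "a \<noteq> b"
  shows "integrable M (\<lambda>\<omega>. (k (Z a \<omega>) (Z b \<omega>)) ^ 4)"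
proof -
  have "integrable (mix \<Otimes>\<^sub>M mix) (\<lambda>z. (case z of (x, y) \<Rightarrow> k x y) ^ 4)"
    using fourth_moment kernel_measurable distr_Z_pair[of 1 2]
    by (subst distr_Z_pair[of 1 2, symmetric], simp, simp, simp, subst integrable_distr_eq) auto
  then show ?thesis
    using assms kernel_measurable
    by (subst (asm) distr_Z_pair[of a b, symmetric], simp, simp, simp, subst (asm) integrable_distr_eq) auto
qed

lemma integrable_kernel_sample_4:
  assumes ab: "a \<in> idx" "b \<in> idx" "a \<noteq> b"
  shows "integrable M (\<lambda>\<omega>. (k (sample a \<omega>) (sample b \<omega>)) ^ 4)"
proof (rule integrableI_nonneg)
  let ?f = "\<lambda>z. ennreal ((case z of (x, y) \<Rightarrow> k x y) ^ 4)"
  have m: "?f \<in> borel_measurable (S \<Otimes>\<^sub>M S)" using kernel_measurable by measurable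
  have "(\<integral>\<^sup>+\<omega>. ennreal ((k (sample a \<omega>) (sample b \<omega>)) ^ 4) \<partial>M) =
      (\<integral>\<^sup>+z. ?f z \<partial>(marg (isl a) \<Otimes>\<^sub>M marg (isl b)))"
    unfolding distr_sample_pair[OF ab, symmetric] using m ab by (subst nn_integral_distr) auto
  also have "\<dots> \<le> ennreal ((1 / minority)\<^sup>2) * (\<integral>\<^sup>+z. ?f z \<partial>(mix \<Otimes>\<^sub>M mix))"
    by (rule nn_integral_marg2_le[OF m])
  also have "(\<integral>\<^sup>+z. ?f z \<partial>(mix \<Otimes>\<^sub>M mix)) = (\<integral>\<^sup>+\<omega>. ennreal ((k (Z 1 \<omega>) (Z 2 \<omega>)) ^ 4) \<partial>M)"
    using m by (subst distr_Z_pair[of 1 2, symmetric], simp, simp, simp, subst nn_integral_distr) auto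
  also have "\<dots> = ennreal (\<integral>\<omega>. (k (Z 1 \<omega>) (Z 2 \<omega>)) ^ 4 \<partial>M)"
    by (rule nn_integral_eq_integral[OF fourth_moment]) simp
  finally show "(\<integral>\<^sup>+\<omega>. ennreal ((k (sample a \<omega>) (sample b \<omega>)) ^ 4) \<partial>M) < \<infinity>"
    by (simp add: ennreal_mult_less_top le_less_trans)
qed (use ab in auto)

end

section \<open>Moments of the four-point contrast\<close>

context energy_model
begin

lemma integrable_kernel_sample_square:
  "\<lbrakk>a \<in> idx; b \<in> idx; a \<noteq> b\<rbrakk> \<Longrightarrow> integrable M (\<lambda>\<omega>. (k (sample a \<omega>) (sample b \<omega>))\<^sup>2)"
  by (intro integrable_lower_square integrable_kernel_sample_4) auto

lemma integrable_kernel_Z_square: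
  "\<lbrakk>1 \<le> a; 1 \<le> b; a \<noteq> b\<rbrakk> \<Longrightarrow> integrable M (\<lambda>\<omega>. (k (Z a \<omega>) (Z b \<omega>))\<^sup>2)"
  by (intro integrable_lower_square integrable_kernel_Z_4) auto

lemma integrable_kernel_sample:
  "\<lbrakk>a \<in> idx; b \<in> idx; a \<noteq> b\<rbrakk> \<Longrightarrow> integrable M (\<lambda>\<omega>. k (sample a \<omega>) (sample b \<omega>))"
  by (rule square_integrable_imp_integrable[OF _ integrable_kernel_sample_square]) auto

lemma integrable_kernel_Z:
  "\<lbrakk>1 \<le> a; 1 \<le> b; a \<noteq> b\<rbrakk> \<Longrightarrow> integrable M (\<lambda>\<omega>. k (Z a \<omega>) (Z b \<omega>))"
  by (rule square_integrable_imp_integrable[OF _ integrable_kernel_Z_square]) auto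

lemma expectation_Z_four:
  fixes F :: "_ \<Rightarrow> real"
  assumes "{a, b, c, d} \<subseteq> {1..}" "distinct [a, b, c, d]" and F: "F \<in> borel_measurable S4"
  shows "(\<integral>\<omega>. F (Z a \<omega>, Z b \<omega>, Z c \<omega>, Z d \<omega>) \<partial>M) = (\<integral>z. F z \<partial>mix4)"
proof -
  have "(\<lambda>\<omega>. (Z a \<omega>, Z b \<omega>, Z c \<omega>, Z d \<omega>)) \<in> measurable M S4"
    using assms(1) by (intro measurable_Pair) auto
  then show ?thesis
    using F by (simp add: integral_distr flip: distr_Z_four[OF assms(1,2)])
qed

lemma expectation_sample_four:
  fixes F :: "_ \<Rightarrow> real"
  assumes "{a, b, c, d} \<subseteq> idx" "distinct [a, b, c, d]" and F: "F \<in> borel_measurable S4"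
  shows "(\<integral>\<omega>. F (sample a \<omega>, sample b \<omega>, sample c \<omega>, sample d \<omega>) \<partial>M) =
    (\<integral>z. F z \<partial>marg4 (isl a, isl b, isl c, isl d))"
proof -
  have "(\<lambda>\<omega>. (sample a \<omega>, sample b \<omega>, sample c \<omega>, sample d \<omega>)) \<in> measurable M S4"
    using assms(1) by (intro measurable_Pair) auto
  then show ?thesis
    using F by (simp add: integral_distr flip: distr_sample_four[OF assms(1,2)])
qed

lemma expectation_sample_pair:
  fixes F :: "_ \<Rightarrow> real"
  assumes ab: "a \<in> idx" "b \<in> idx" "a \<noteq> b" and F: "F \<in> borel_measurable (S \<Otimes>\<^sub>M S)"
  shows "(\<integral>\<omega>. F (sample a \<omega>, sample b \<omega>) \<partial>M) = (\<integral>z. F z \<partial>(marg (isl a) \<Otimes>\<^sub>M marg (isl b)))"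
proof -
  have "(\<lambda>\<omega>. (sample a \<omega>, sample b \<omega>)) \<in> measurable M (S \<Otimes>\<^sub>M S)"
    using ab by (intro measurable_Pair) auto
  then show ?thesis
    using F by (simp add: integral_distr flip: distr_sample_pair[OF ab])
qed

lemma quad_square_expand:
  "(quad k w x y z)\<^sup>2 = (k w x)\<^sup>2 + (k y z)\<^sup>2 + (k w y)\<^sup>2 + (k x z)\<^sup>2
     + 2 * (k w x * k y z) - 2 * (k w x * k w y) - 2 * (k w x * k x z)
     - 2 * (k y z * k w y) - 2 * (k y z * k x z) + 2 * (k w y * k x z)"
  unfolding quad_def by (simp add: power2_eq_square algebra_simps)

text \<open>
  Of the ten terms in the expansion of the squared contrast, the four squares have equal
  expectations, the two products without common argument have expectation
  \<open>(E k)\<^sup>2\<close> by independence, and the four products with one common argument agree by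
  exchangeability. The sum is four times the defining expression of \<open>dvar2\<close>.
\<close>

lemma expectation_quad_Z_square:
  "(\<integral>\<omega>. (quad k (Z 1 \<omega>) (Z 2 \<omega>) (Z 3 \<omega>) (Z 4 \<omega>))\<^sup>2 \<partial>M) = 4 * V2"
proof -
  let ?K = "\<lambda>a b \<omega>. k (Z a \<omega>) (Z b \<omega>)"
  define e2 where "e2 = (\<integral>\<omega>. (?K 1 2 \<omega>)\<^sup>2 \<partial>M)"
  define e11 where "e11 = (\<integral>\<omega>. ?K 1 2 \<omega> * ?K 1 3 \<omega> \<partial>M)"
  define e1 where "e1 = (\<integral>\<omega>. ?K 1 2 \<omega> \<partial>M)"
  have sym: "k (Z a \<omega>) (Z b \<omega>) = k (Z b \<omega>) (Z a \<omega>)" if "\<omega> \<in> space M" "1 \<le> a" "1 \<le> b" for a b \<omega>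
    using that by (intro kernel_sym Z_space)
  have four: "(\<integral>\<omega>. F (Z a \<omega>) (Z b \<omega>) (Z c \<omega>) (Z d \<omega>) \<partial>M) = (\<integral>\<omega>. F (Z 1 \<omega>) (Z 2 \<omega>) (Z 3 \<omega>) (Z 4 \<omega>) \<partial>M)"
    if "{a, b, c, d} \<subseteq> {1..}" "distinct [a, b, c, d]"
      and "(\<lambda>(w, x, y, z). F w x y z) \<in> borel_measurable S4" for a b c d and F :: "_ \<Rightarrow> _ \<Rightarrow> _ \<Rightarrow> _ \<Rightarrow> real"
    using expectation_Z_four[OF that] expectation_Z_four[OF _ _ that(3), of 1 2 3 4] by simp
  have mF: "(\<lambda>(w, x, y, z). (k w x)\<^sup>2) \<in> borel_measurable S4" 
    "(\<lambda>(w, x, y, z). k w x) \<in> borel_measurable S4"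
    "(\<lambda>(w, x, y, z). k w x * k w y) \<in> borel_measurable S4" by measurable
  have i2: "(\<integral>\<omega>. (?K 3 4 \<omega>)\<^sup>2 \<partial>M) = e2" "(\<integral>\<omega>. (?K 1 3 \<omega>)\<^sup>2 \<partial>M) = e2" "(\<integral>\<omega>. (?K 2 4 \<omega>)\<^sup>2 \<partial>M) = e2"
    using four[OF _ _ mF(1), of 3 4 1 2] four[OF _ _ mF(1), of 1 3 2 4] four[OF _ _ mF(1), of 2 4 1 3]
    by (simp_all add: e2_def)
  have i1: "(\<integral>\<omega>. ?K 3 4 \<omega> \<partial>M) = e1" "(\<integral>\<omega>. ?K 1 3 \<omega> \<partial>M) = e1" "(\<integral>\<omega>. ?K 2 4 \<omega> \<partial>M) = e1"
    using four[OF _ _ mF(2), of 3 4 1 2] four[OF _ _ mF(2), of 1 3 2 4] four[OF _ _ mF(2), of 2 4 1 3]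
    by (simp_all add: e1_def)
  have i11: "(\<integral>\<omega>. ?K 1 2 \<omega> * ?K 2 4 \<omega> \<partial>M) = e11"
    "(\<integral>\<omega>. ?K 3 4 \<omega> * ?K 1 3 \<omega> \<partial>M) = e11"
    "(\<integral>\<omega>. ?K 3 4 \<omega> * ?K 2 4 \<omega> \<partial>M) = e11"
  proof -
    have "(\<integral>\<omega>. ?K 1 2 \<omega> * ?K 2 4 \<omega> \<partial>M) = (\<integral>\<omega>. ?K 2 1 \<omega> * ?K 2 4 \<omega> \<partial>M)"
      by (intro Bochner_Integration.integral_cong refl) (metis sym one_le_numeral order_refl)
    then show "(\<integral>\<omega>. ?K 1 2 \<omega> * ?K 2 4 \<omega> \<partial>M) = e11"
      using four[OF _ _ mF(3), of 2 1 4 3] by (simp add: e11_def)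
    have "(\<integral>\<omega>. ?K 3 4 \<omega> * ?K 1 3 \<omega> \<partial>M) = (\<integral>\<omega>. ?K 3 4 \<omega> * ?K 3 1 \<omega> \<partial>M)"
      by (intro Bochner_Integration.integral_cong refl) (metis sym one_le_numeral order_refl)
    then show "(\<integral>\<omega>. ?K 3 4 \<omega> * ?K 1 3 \<omega> \<partial>M) = e11"
      using four[OF _ _ mF(3), of 3 4 1 2] by (simp add: e11_def)
    have "(\<integral>\<omega>. ?K 3 4 \<omega> * ?K 2 4 \<omega> \<partial>M) = (\<integral>\<omega>. ?K 4 3 \<omega> * ?K 4 2 \<omega> \<partial>M)"
      by (intro Bochner_Integration.integral_cong refl) (metis sym one_le_numeral)
    then show "(\<integral>\<omega>. ?K 3 4 \<omega> * ?K 2 4 \<omega> \<partial>M) = e11"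
      using four[OF _ _ mF(3), of 4 3 2 1] by (simp add: e11_def)
  qed
  have iv: "(\<integral>\<omega>. ?K a b \<omega> * ?K c d \<omega> \<partial>M) = (\<integral>\<omega>. ?K a b \<omega> \<partial>M) * (\<integral>\<omega>. ?K c d \<omega> \<partial>M)"
    if "{a, b, c, d} \<subseteq> {1..}" "distinct [a, b, c, d]" for a b c d
  proof (rule indep_var_lebesgue_integral)
    have "indep_var borel (\<lambda>\<omega>. (\<lambda>x. k (x a) (x b)) (\<lambda>i\<in>{a, b}. Z i \<omega>))
       borel (\<lambda>\<omega>. (\<lambda>x. k (x c) (x d)) (\<lambda>i\<in>{c, d}. Z i \<omega>))"
      using that by (intro indep_var_of_disjoint[OF indep_Z]) auto
    then show "indep_var borel (?K a b) borel (?K c d)" by simp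
  qed (use that in \<open>auto intro!: integrable_kernel_Z\<close>)
  have ind: "(\<integral>\<omega>. ?K 1 2 \<omega> * ?K 3 4 \<omega> \<partial>M) = e1\<^sup>2" "(\<integral>\<omega>. ?K 1 3 \<omega> * ?K 2 4 \<omega> \<partial>M) = e1\<^sup>2"
    using iv[of 1 2 3 4] iv[of 1 3 2 4] i1 by (simp_all add: power2_eq_square e1_def)
  have sq: "integrable M (\<lambda>\<omega>. (?K a b \<omega>)\<^sup>2)" if "1 \<le> a" "1 \<le> b" "a \<noteq> b" for a b
    using that by (rule integrable_kernel_Z_square)
  have pr: "integrable M (\<lambda>\<omega>. ?K a b \<omega> * ?K c d \<omega>)"
    if "1 \<le> a" "1 \<le> b" "a \<noteq> b" "1 \<le> c" "1 \<le> d" "c \<noteq> d" for a b c d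
    using that by (intro square_integrable_imp_integrable_mult sq) auto
  have "(\<integral>\<omega>. (quad k (Z 1 \<omega>) (Z 2 \<omega>) (Z 3 \<omega>) (Z 4 \<omega>))\<^sup>2 \<partial>M) =
     e2 + e2 + e2 + e2 + 2 * e1\<^sup>2 - 2 * e11 - 2 * e11 - 2 * e11 - 2 * e11 + 2 * e1\<^sup>2"
    unfolding quad_square_expand
    using i2 i11 ind e2_def e11_def by (simp add: sq pr)
  also have "\<dots> = 4 * V2"
    by (simp add: dvar2_def e2_def e11_def e1_def)
  finally show ?thesis .
qed

lemma V2_nonneg: "0 \<le> V2"
  using expectation_quad_Z_square
    Bochner_Integration.integral_nonneg[of M "\<lambda>\<omega>. (quad k (Z 1 \<omega>) (Z 2 \<omega>) (Z 3 \<omega>) (Z 4 \<omega>))\<^sup>2"]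
  by simp

lemma integrable_quad_sample_square:
  assumes "{a, b, c, d} \<subseteq> idx" "distinct [a, b, c, d]"
  shows "integrable M (\<lambda>\<omega>. (quad k (sample a \<omega>) (sample b \<omega>) (sample c \<omega>) (sample d \<omega>))\<^sup>2)"
  unfolding quad_def using assms
  by (intro square_integrable_sum integrable_kernel_sample_square) auto

lemma integrable_quad_Z_square:
  "integrable M (\<lambda>\<omega>. (quad k (Z 1 \<omega>) (Z 2 \<omega>) (Z 3 \<omega>) (Z 4 \<omega>))\<^sup>2)"
  unfolding quad_def
  by (intro square_integrable_sum integrable_kernel_Z_square) auto

lemma nn_integral_quad_mix4:
  "(\<integral>\<^sup>+(w, x, y, z). ennreal ((quad k w x y z)\<^sup>2) \<partial>mix4) = ennreal (4 * V2)"
proof -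
  have [measurable]: "(\<lambda>\<omega>. (Z 1 \<omega>, Z 2 \<omega>, Z 3 \<omega>, Z 4 \<omega>)) \<in> measurable M S4"
    by (intro measurable_Pair) auto
  have "(\<integral>\<^sup>+(w, x, y, z). ennreal ((quad k w x y z)\<^sup>2) \<partial>mix4) =
     (\<integral>\<^sup>+\<omega>. ennreal ((quad k (Z 1 \<omega>) (Z 2 \<omega>) (Z 3 \<omega>) (Z 4 \<omega>))\<^sup>2) \<partial>M)"
    by (subst distr_Z_four[of 1 2 3 4, symmetric], simp, simp, subst nn_integral_distr) auto
  then show ?thesis
    using nn_integral_eq_integral[OF integrable_quad_Z_square] expectation_quad_Z_square by simp
qed

lemma nn_integral_quad_marg4:
  assumes "{a, b, c, d} \<subseteq> idx" "distinct [a, b, c, d]"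
  shows "(\<integral>\<^sup>+(w, x, y, z). ennreal ((quad k w x y z)\<^sup>2) \<partial>marg4 (isl a, isl b, isl c, isl d)) =
    ennreal (\<integral>\<omega>. (quad k (sample a \<omega>) (sample b \<omega>) (sample c \<omega>) (sample d \<omega>))\<^sup>2 \<partial>M)"
proof -
  have [measurable]: "(\<lambda>\<omega>. (sample a \<omega>, sample b \<omega>, sample c \<omega>, sample d \<omega>)) \<in> measurable M S4"
    using assms by (intro measurable_Pair) auto
  have "(\<integral>\<^sup>+(w, x, y, z). ennreal ((quad k w x y z)\<^sup>2) \<partial>marg4 (isl a, isl b, isl c, isl d)) =
     (\<integral>\<^sup>+\<omega>. ennreal ((quad k (sample a \<omega>) (sample b \<omega>) (sample c \<omega>) (sample d \<omega>))\<^sup>2) \<partial>M)"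
    by (subst distr_sample_four[OF assms, symmetric], subst nn_integral_distr) auto
  then show ?thesis
    using nn_integral_eq_integral[OF integrable_quad_sample_square[OF assms]] by simp
qed

lemma expectation_quad_sample_square_le:
  assumes "{a, b, c, d} \<subseteq> idx" "distinct [a, b, c, d]"
  shows "(\<integral>\<omega>. (quad k (sample a \<omega>) (sample b \<omega>) (sample c \<omega>) (sample d \<omega>))\<^sup>2 \<partial>M) \<le> 4 * V2 / minority ^ 4"
proof -
  have m: "(\<lambda>(w, x, y, z). ennreal ((quad k w x y z)\<^sup>2)) \<in> borel_measurable S4" by measurable
  show ?thesis
    using nn_integral_marg4_le[OF m, of "(isl a, isl b, isl c, isl d)"] V2_nonneg minority
    unfolding nn_integral_quad_mix4 nn_integral_quad_marg4[OF assms]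
    by (simp add: power_divide flip: ennreal_mult)
qed

text \<open>
  Block \<open>l\<close> consists of the observations with numbers \<open>4 l + 1\<close> to \<open>4 l + 4\<close> in
  both samples. It has room for a contrast with any pattern of labels, and different blocks are
  independent.
\<close>

definition block_index :: "bool \<Rightarrow> nat \<Rightarrow> nat + nat" where
  "block_index b i = (if b then Inl i else Inr i)"

lemma isl_block_index[simp]: "isl (block_index b i) = b"
  and block_index_idx[simp]: "block_index b i \<in> idx \<longleftrightarrow> 1 \<le> i"
  and block_index_eq[simp]: "block_index b i = block_index c j \<longleftrightarrow> b = c \<and> i = j"
  by (auto simp: block_index_def)

definition block_quad :: "bool \<times> bool \<times> bool \<times> bool \<Rightarrow> nat \<Rightarrow> 'a \<Rightarrow> real" where
  "block_quad L l \<omega> = (case L of (b1, b2, b3, b4) \<Rightarrow>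
     quad k (sample (block_index b1 (4 * l + 1)) \<omega>) (sample (block_index b2 (4 * l + 2)) \<omega>)
       (sample (block_index b3 (4 * l + 3)) \<omega>) (sample (block_index b4 (4 * l + 4)) \<omega>))"

text \<open>
  The second moment \<open>4 V2\<close> under the mixture is an average over the sixteen label patterns,
  so at least one pattern attains it.
\<close>

lemma exists_block_quad_square_ge:
  "\<exists>L. \<forall>l. 4 * V2 \<le> (\<integral>\<omega>. (block_quad L l \<omega>)\<^sup>2 \<partial>M)"
proof -
  have m: "(\<lambda>(w, x, y, z). ennreal ((quad k w x y z)\<^sup>2)) \<in> borel_measurable S4" by measurable
  obtain b1 b2 b3 b4 where L: "ennreal (4 * V2) \<le>
      (\<integral>\<^sup>+(w, x, y, z). ennreal ((quad k w x y z)\<^sup>2) \<partial>marg4 (b1, b2, b3, b4))"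
    using nn_integral_mix4_le_some[OF m] unfolding nn_integral_quad_mix4 by auto
  have "4 * V2 \<le> (\<integral>\<omega>. (block_quad (b1, b2, b3, b4) l \<omega>)\<^sup>2 \<partial>M)" for l
    using L nn_integral_quad_marg4[of "block_index b1 (4 * l + 1)" "block_index b2 (4 * l + 2)"
       "block_index b3 (4 * l + 3)" "block_index b4 (4 * l + 4)"]
    by (simp add: block_quad_def ennreal_le_iff)
  then show ?thesis by blast
qed

definition kmean :: "bool \<Rightarrow> bool \<Rightarrow> real" where
  "kmean b c = (if b \<and> c then \<integral>\<omega>. k (X 1 \<omega>) (X 2 \<omega>) \<partial>M
     else if b \<or> c then \<integral>\<omega>. k (X 1 \<omega>) (Y 1 \<omega>) \<partial>M else \<integral>\<omega>. k (Y 1 \<omega>) (Y 2 \<omega>) \<partial>M)"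

text \<open>
  For a symmetric function only the labels of the two observations matter, which leaves three
  reference pairs.
\<close>

lemma expectation_symmetric_pair:
  fixes F :: "_ \<Rightarrow> _ \<Rightarrow> real"
  assumes ab: "a \<in> idx" "b \<in> idx" "a \<noteq> b" and F: "case_prod F \<in> borel_measurable (S \<Otimes>\<^sub>M S)"
    and sym: "\<And>x y. x \<in> space S \<Longrightarrow> y \<in> space S \<Longrightarrow> F x y = F y x"
  shows "(\<integral>\<omega>. F (sample a \<omega>) (sample b \<omega>) \<partial>M) =
    (if isl a \<and> isl b then \<integral>\<omega>. F (X 1 \<omega>) (X 2 \<omega>) \<partial>M
     else if isl a \<or> isl b then \<integral>\<omega>. F (X 1 \<omega>) (Y 1 \<omega>) \<partial>M else \<integral>\<omega>. F (Y 1 \<omega>) (Y 2 \<omega>) \<partial>M)"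
proof -
  have eq: "(\<integral>\<omega>. F (sample a \<omega>) (sample b \<omega>) \<partial>M) = (\<integral>\<omega>. F (sample c \<omega>) (sample d \<omega>) \<partial>M)"
    if "a \<in> idx" "b \<in> idx" "a \<noteq> b" "c \<in> idx" "d \<in> idx" "c \<noteq> d" "isl a = isl c" "isl b = isl d" for a b c d
    using expectation_sample_pair[OF that(1-3) F] expectation_sample_pair[OF that(4-6) F] that by simp
  have swap: "(\<integral>\<omega>. F (sample a \<omega>) (sample b \<omega>) \<partial>M) = (\<integral>\<omega>. F (sample b \<omega>) (sample a \<omega>) \<partial>M)"
    using ab by (intro Bochner_Integration.integral_cong refl sym sample_space)
  show ?thesis
    using ab eq[of a b "Inl 1" "Inl 2"] eq[of a b "Inl 1" "Inr 1"] eq[of b a "Inl 1" "Inr 1"]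
      eq[of a b "Inr 1" "Inr 2"] swap
    by (simp add: sample_def)
qed

lemma expectation_kernel_sample:
  assumes "a \<in> idx" "b \<in> idx" "a \<noteq> b"
  shows "(\<integral>\<omega>. k (sample a \<omega>) (sample b \<omega>) \<partial>M) = kmean (isl a) (isl b)"
  unfolding kmean_def
  using assms kernel_measurable kernel_sym by (intro expectation_symmetric_pair) auto

text \<open>
  For each of the sixteen label patterns the means of the four kernel values in a contrast combine
  to \<open>0\<close>, \<open>En\<close> or \<open>- En\<close>. Hence contrasts, although built from uncentred
  kernel values, inherit the moments of the centred ones.
\<close>

lemma abs_kmean_contrast_le: "\<bar>kmean b1 b2 + kmean b3 b4 - kmean b1 b3 - kmean b2 b4\<bar> \<le> \<bar>En\<bar>"
  by (cases b1; cases b2; cases b3; cases b4) (simp_all add: kmean_def energy_dist_def)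

definition centered_moment :: "real \<Rightarrow> real" where
  "centered_moment q = (\<integral>\<omega>. \<bar>centered M k (X 1) (X 2) \<omega>\<bar> powr q + \<bar>centered M k (X 1) (Y 1) \<omega>\<bar> powr q
     + \<bar>centered M k (Y 1) (Y 2) \<omega>\<bar> powr q \<partial>M)"

context
  fixes q :: real
  assumes q: "0 \<le> q" "q \<le> 4"
begin

lemma integrable_centered_sample_powr:
  assumes ab: "a \<in> idx" "b \<in> idx" "a \<noteq> b"
  shows "integrable M (\<lambda>\<omega>. \<bar>k (sample a \<omega>) (sample b \<omega>) - c\<bar> powr q)"
proof (rule integrable_lower_power[OF _ _ q])
  let ?f = "\<lambda>\<omega>. k (sample a \<omega>) (sample b \<omega>)"
  show m: "(\<lambda>\<omega>. ?f \<omega> - c) \<in> borel_measurable M" using ab by auto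
  show "integrable M (\<lambda>\<omega>. (?f \<omega> - c) ^ 4)"
  proof (rule Bochner_Integration.integrable_bound)
    show "integrable M (\<lambda>\<omega>. 8 * (?f \<omega> ^ 4 + c ^ 4))"
      using integrable_kernel_sample_4[OF ab] by simp
    have "(u - c) ^ 4 \<le> 8 * (u ^ 4 + c ^ 4)" for u
    proof -
      have "(u - c)\<^sup>2 \<le> 2 * (u\<^sup>2 + c\<^sup>2)"
        using zero_le_power2[of "u + c"] by (simp add: power2_sum power2_diff)
      then have "((u - c)\<^sup>2)\<^sup>2 \<le> (2 * (u\<^sup>2 + c\<^sup>2))\<^sup>2"
        by (intro power_mono) auto
      also have "\<dots> \<le> 8 * ((u\<^sup>2)\<^sup>2 + (c\<^sup>2)\<^sup>2)"
        using zero_le_power2[of "u\<^sup>2 - c\<^sup>2"] by (simp add: power2_sum power2_diff power_mult_distrib)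
      finally show ?thesis by simp
    qed
    then show "AE \<omega> in M. norm ((?f \<omega> - c) ^ 4) \<le> norm (8 * (?f \<omega> ^ 4 + c ^ 4))"
      by simp
  qed (use m in measurable)
qed

lemma expectation_centered_powr_le:
  assumes ab: "a \<in> idx" "b \<in> idx" "a \<noteq> b"
  shows "(\<integral>\<omega>. \<bar>k (sample a \<omega>) (sample b \<omega>) - kmean (isl a) (isl b)\<bar> powr q \<partial>M) \<le> centered_moment q"
proof -
  let ?c = "kmean (isl a) (isl b)"
  have int: "integrable M (\<lambda>\<omega>. \<bar>centered M k (X 1) (X 2) \<omega>\<bar> powr q)"
    "integrable M (\<lambda>\<omega>. \<bar>centered M k (X 1) (Y 1) \<omega>\<bar> powr q)"
    "integrable M (\<lambda>\<omega>. \<bar>centered M k (Y 1) (Y 2) \<omega>\<bar> powr q)"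
    using integrable_centered_sample_powr[of "Inl 1" "Inl 2"] integrable_centered_sample_powr[of "Inl 1" "Inr 1"]
      integrable_centered_sample_powr[of "Inr 1" "Inr 2"]
    unfolding centered_def by (simp_all add: sample_def)
  have m: "(\<lambda>(x, y). \<bar>k x y - ?c\<bar> powr q) \<in> borel_measurable (S \<Otimes>\<^sub>M S)" by measurable
  have "(\<integral>\<omega>. \<bar>k (sample a \<omega>) (sample b \<omega>) - ?c\<bar> powr q \<partial>M) =
     (if isl a \<and> isl b then \<integral>\<omega>. \<bar>centered M k (X 1) (X 2) \<omega>\<bar> powr q \<partial>M
      else if isl a \<or> isl b then \<integral>\<omega>. \<bar>centered M k (X 1) (Y 1) \<omega>\<bar> powr q \<partial>M
      else \<integral>\<omega>. \<bar>centered M k (Y 1) (Y 2) \<omega>\<bar> powr q \<partial>M)"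
    by (subst expectation_symmetric_pair[OF ab m])
      (auto simp: kernel_sym centered_def kmean_def)
  also have "\<dots> \<le> centered_moment q"
    using int by (simp add: centered_moment_def add_increasing add_increasing2)
  finally show ?thesis .
qed

lemma quad_sample_powr:
  assumes abcd: "{a, b, c, d} \<subseteq> idx" "distinct [a, b, c, d]"
  defines "Q \<equiv> \<lambda>\<omega>. quad k (sample a \<omega>) (sample b \<omega>) (sample c \<omega>) (sample d \<omega>)"
  shows "integrable M (\<lambda>\<omega>. \<bar>Q \<omega>\<bar> powr q)"
    and "(\<integral>\<omega>. \<bar>Q \<omega>\<bar> powr q \<partial>M) \<le> 5 powr q * (4 * centered_moment q + \<bar>En\<bar> powr q)"
proof -
  let ?C = "\<lambda>a b \<omega>. k (sample a \<omega>) (sample b \<omega>) - kmean (isl a) (isl b)"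
  define e where "e = kmean (isl a) (isl b) + kmean (isl c) (isl d) - kmean (isl a) (isl c) - kmean (isl b) (isl d)"
  define B where "B \<omega> = 5 powr q * (\<bar>?C a b \<omega>\<bar> powr q + \<bar>?C c d \<omega>\<bar> powr q + \<bar>?C a c \<omega>\<bar> powr q
      + \<bar>?C b d \<omega>\<bar> powr q + \<bar>e\<bar> powr q)" for \<omega>
  have le: "\<bar>Q \<omega>\<bar> powr q \<le> B \<omega>" for \<omega>
  proof -
    have "Q \<omega> = ?C a b \<omega> + ?C c d \<omega> + (- ?C a c \<omega>) + (- ?C b d \<omega>) + e"
      by (simp add: Q_def quad_def e_def)
    then show ?thesis
      using powr_abs_sum_le[OF q(1), of "{..<5}" "(!) [?C a b \<omega>, ?C c d \<omega>, - ?C a c \<omega>, - ?C b d \<omega>, e]"]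
      unfolding B_def by (simp add: eval_nat_numeral add.assoc[symmetric]
        abs_minus_commute[of "kmean (isl a) (isl c)"] abs_minus_commute[of "kmean (isl b) (isl d)"])
  qed
  have int: "integrable M (\<lambda>\<omega>. \<bar>?C a b \<omega>\<bar> powr q)" "integrable M (\<lambda>\<omega>. \<bar>?C c d \<omega>\<bar> powr q)"
    "integrable M (\<lambda>\<omega>. \<bar>?C a c \<omega>\<bar> powr q)" "integrable M (\<lambda>\<omega>. \<bar>?C b d \<omega>\<bar> powr q)"
    using abcd by (auto intro!: integrable_centered_sample_powr)
  have intB: "integrable M B" unfolding B_def using int by simp
  have [measurable]: "Q \<in> borel_measurable M" unfolding Q_def using abcd by auto
  show intQ: "integrable M (\<lambda>\<omega>. \<bar>Q \<omega>\<bar> powr q)"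
    by (rule Bochner_Integration.integrable_bound[OF intB])
      (use le in \<open>auto intro: order_trans[OF _ abs_ge_self]\<close>)
  have "(\<integral>\<omega>. \<bar>Q \<omega>\<bar> powr q \<partial>M) \<le> (\<integral>\<omega>. B \<omega> \<partial>M)"
    using intQ intB le by (intro integral_mono)
  also have "\<dots> = 5 powr q * ((\<integral>\<omega>. \<bar>?C a b \<omega>\<bar> powr q \<partial>M) + (\<integral>\<omega>. \<bar>?C c d \<omega>\<bar> powr q \<partial>M)
     + (\<integral>\<omega>. \<bar>?C a c \<omega>\<bar> powr q \<partial>M) + (\<integral>\<omega>. \<bar>?C b d \<omega>\<bar> powr q \<partial>M) + \<bar>e\<bar> powr q)"
    unfolding B_def using int by (simp add: prob_space)
  also have "\<dots> \<le> 5 powr q * (centered_moment q + centered_moment q + centered_moment q + centered_moment q + \<bar>En\<bar> powr q)"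
    using abcd q abs_kmean_contrast_le
    by (intro mult_left_mono add_mono expectation_centered_powr_le powr_mono2) (auto simp: e_def)
  finally show "(\<integral>\<omega>. \<bar>Q \<omega>\<bar> powr q \<partial>M) \<le> 5 powr q * (4 * centered_moment q + \<bar>En\<bar> powr q)"
    by simp
qed

end

text \<open>
  Combines the truncation bound with the moment bound; \<open>level\<close> will be taken proportional to
  \<open>N V2\<close>, which makes the tail term smaller than the second moment.
\<close>

lemma prob_quad_sample_nonzero:
  assumes abcd: "{a, b, c, d} \<subseteq> idx" "distinct [a, b, c, d]"
    and tau: "0 < \<tau>" "\<tau> \<le> 1" and lam: "0 < level"
  defines "Q \<equiv> \<lambda>\<omega>. quad k (sample a \<omega>) (sample b \<omega>) (sample c \<omega>) (sample d \<omega>)"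
  shows "(\<integral>\<omega>. (Q \<omega>)\<^sup>2 \<partial>M) \<le> level * \<P>(\<omega> in M. Q \<omega> \<noteq> 0)
    + level powr (- \<tau>) * (5 powr (2 + 2 * \<tau>) * (4 * centered_moment (2 + 2 * \<tau>) + \<bar>En\<bar> powr (2 + 2 * \<tau>)))"
proof -
  have q: "0 \<le> 2 + 2 * \<tau>" "2 + 2 * \<tau> \<le> 4" using tau by auto
  note P = quad_sample_powr[OF q abcd]
  have Q: "Q \<in> borel_measurable M" unfolding Q_def using abcd by auto
  have "(\<integral>\<omega>. (Q \<omega>)\<^sup>2 \<partial>M) \<le> level * \<P>(\<omega> in M. Q \<omega> \<noteq> 0)
    + level powr (- \<tau>) * (\<integral>\<omega>. \<bar>Q \<omega>\<bar> powr (2 + 2 * \<tau>) \<partial>M)"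
    using integrable_quad_sample_square[OF abcd] P(1) tau lam
    by (intro second_moment_le_prob_nonzero[OF Q]) (auto simp: Q_def)
  also have "\<dots> \<le> level * \<P>(\<omega> in M. Q \<omega> \<noteq> 0)
    + level powr (- \<tau>) * (5 powr (2 + 2 * \<tau>) * (4 * centered_moment (2 + 2 * \<tau>) + \<bar>En\<bar> powr (2 + 2 * \<tau>)))"
    using P(2) by (intro add_left_mono mult_left_mono) (simp_all add: Q_def)
  finally show ?thesis .
qed

end

section \<open>The variance estimator\<close>

context energy_model
begin

definition pooled_index :: "nat \<Rightarrow> nat \<Rightarrow> nat + nat" where
  "pooled_index n s = (if s \<le> n then Inl s else Inr (s - n))"

lemma pooled_index_idx[simp]: "pooled_index n s \<in> idx \<longleftrightarrow> 1 \<le> s"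
  by (auto simp: pooled_index_def)

lemma pooled_index_eq[simp]: "pooled_index n s = pooled_index n t \<longleftrightarrow> s = t"
  by (auto simp: pooled_index_def)

lemma pooled_sample: "pooled n (\<lambda>i. X i \<omega>) (\<lambda>j. Y j \<omega>) s = sample (pooled_index n s) \<omega>"
  by (simp add: pooled_def pooled_index_def sample_def)

definition gram :: "nat \<Rightarrow> 'a \<Rightarrow> nat \<Rightarrow> nat \<Rightarrow> real" where
  "gram n \<omega> s t = k (sample (pooled_index n s) \<omega>) (sample (pooled_index n t) \<omega>)"

lemma quad_gram: "quad (gram n \<omega>) s t i j = quad k (sample (pooled_index n s) \<omega>)
    (sample (pooled_index n t) \<omega>) (sample (pooled_index n i) \<omega>) (sample (pooled_index n j) \<omega>)"
  by (simp add: quad_def gram_def)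

lemma gram_measurable[measurable]:
  "\<lbrakk>1 \<le> s; 1 \<le> t\<rbrakk> \<Longrightarrow> (\<lambda>\<omega>. gram n \<omega> s t) \<in> borel_measurable M"
  unfolding gram_def by auto

lemma symmetric_array_gram:
  "\<lbrakk>\<omega> \<in> space M; 4 \<le> N\<rbrakk> \<Longrightarrow> symmetric_array N (gram n \<omega>) a0"
  by standard (auto simp: gram_def intro!: kernel_sym kernel_diag sample_space)

definition var_est :: "nat \<Rightarrow> nat \<Rightarrow> 'a \<Rightarrow> real" where
  "var_est n m \<omega> = var_stat k a0 n m (\<lambda>i. X i \<omega>) (\<lambda>j. Y j \<omega>)"

lemma var_est_u_centered:
  "var_est n m \<omega> = 1 / (real (n + m) * (real (n + m) - 3)) *
     (\<Sum>s=1..n+m. \<Sum>t\<in>{1..n+m} - {s}. (u_centered (n + m) (gram n \<omega>) s t)\<^sup>2)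
     - a0\<^sup>2 / ((real (n + m) - 1) * (real (n + m) - 3))"
  unfolding var_est_def var_stat_def Let_def pooled_sample gram_def[symmetric] by simp

text \<open>
  The diagonal correction cancels exactly, which leaves a sum of squares.
\<close>

lemma var_est_eq:
  assumes \<omega>: "\<omega> \<in> space M" and N: "4 \<le> n + m"
  shows "var_est n m \<omega> = 1 / (real (n + m) * (real (n + m) - 3)) *
     (\<Sum>s=1..n+m. \<Sum>t\<in>{1..n+m} - {s}.
       (symmetric_array.offdiag_centered (n + m) (gram n \<omega>) a0 s t)\<^sup>2)"
proof -
  interpret symmetric_array "n + m" "gram n \<omega>" a0
    by (rule symmetric_array_gram[OF assms])
  define N where "N = n + m"
  have N: "real N > 0" "real N - 1 > 0" "real N - 3 > 0" using assms(2) by (auto simp: N_def)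
  have "1 / (real N * (real N - 3)) * (real N * a0\<^sup>2 / (real N - 1)) = a0\<^sup>2 / ((real N - 1) * (real N - 3))"
    using N by (simp add: divide_simps)
  then show ?thesis
    unfolding var_est_u_centered sum_u_centered_squares unfolding N_def[symmetric] distrib_left by simp
qed

lemma var_est_nonneg:
  assumes \<omega>: "\<omega> \<in> space M" and N: "4 \<le> n + m"
  shows "0 \<le> var_est n m \<omega>"
  unfolding var_est_eq[OF assms] using N by (intro mult_nonneg_nonneg sum_nonneg) auto

text \<open>
  If the sum of squares vanishes, so do all centred entries, and contrasts can be computed from
  these.
\<close>

lemma quad_eq_0_if_var_est_eq_0:
  assumes \<omega>: "\<omega> \<in> space M" and N: "4 \<le> n + m" and zero: "var_est n m \<omega> = 0"
    and stij: "{s, t, i, j} \<subseteq> {1..n+m}" "distinct [s, t, i, j]"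
  shows "quad (gram n \<omega>) s t i j = 0"
proof -
  interpret symmetric_array "n + m" "gram n \<omega>" a0
    by (rule symmetric_array_gram[OF \<omega> N])
  have "(\<Sum>s=1..n+m. \<Sum>t\<in>{1..n+m} - {s}. (offdiag_centered s t)\<^sup>2) = 0"
    using zero N unfolding var_est_eq[OF \<omega> N] by auto
  then have "\<forall>s\<in>{1..n+m}. (\<Sum>t\<in>{1..n+m} - {s}. (offdiag_centered s t)\<^sup>2) = 0"
    by (subst (asm) sum_nonneg_eq_0_iff) (auto intro: sum_nonneg)
  then have B: "offdiag_centered s t = 0" if "s \<in> {1..n+m}" "t \<in> {1..n+m}" "s \<noteq> t" for s t
    using that by (subst (asm) sum_nonneg_eq_0_iff) auto
  have "quad (gram n \<omega>) s t i j = quad offdiag_centered s t i j"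
    using stij by (intro quad_eq_offdiag_centered) auto
  then show ?thesis using stij B by (simp add: quad_def)
qed

lemma block_quad_measurable[measurable]: "block_quad L l \<in> borel_measurable M"
  unfolding block_quad_def by (cases L) simp

lemma block_quad_eq_0_if_var_est_eq_0:
  assumes \<omega>: "\<omega> \<in> space M" and K: "4 * K \<le> n" "4 * K \<le> m" and l: "l < K" and zero: "var_est n m \<omega> = 0"
  shows "block_quad L l \<omega> = 0"
proof -
  obtain b1 b2 b3 b4 where L: "L = (b1, b2, b3, b4)" by (cases L) auto
  have idx: "block_index b i = pooled_index n (if b then i else n + i)" if "1 \<le> i" "i \<le> n" for b i
    using that by (auto simp: block_index_def pooled_index_def)
  have "block_quad L l \<omega> = quad (gram n \<omega>) (if b1 then 4 * l + 1 else n + (4 * l + 1))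
    (if b2 then 4 * l + 2 else n + (4 * l + 2)) (if b3 then 4 * l + 3 else n + (4 * l + 3))
    (if b4 then 4 * l + 4 else n + (4 * l + 4))"
    unfolding quad_gram block_quad_def L prod.case using K l by (subst (1 2 3 4) idx) auto
  also have "\<dots> = 0"
    by (rule quad_eq_0_if_var_est_eq_0[OF \<omega> _ zero]) (use K l in auto)
  finally show ?thesis .
qed

lemma prob_all_blocks_zero:
  assumes "0 < K"
  shows "\<P>(\<omega> in M. \<forall>l<K. block_quad L l \<omega> = 0) = (\<Prod>l<K. \<P>(\<omega> in M. block_quad L l \<omega> = 0))"
proof -
  obtain b1 b2 b3 b4 where L: "L = (b1, b2, b3, b4)" by (cases L) auto
  define I where "I l = {block_index b1 (4 * l + 1), block_index b2 (4 * l + 2),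
      block_index b3 (4 * l + 3), block_index b4 (4 * l + 4)}" for l
  define D where "D l x = quad k (x (block_index b1 (4 * l + 1))) (x (block_index b2 (4 * l + 2)))
      (x (block_index b3 (4 * l + 3))) (x (block_index b4 (4 * l + 4)))" for l and x :: "nat + nat \<Rightarrow> nat \<Rightarrow> real"
  have "disjoint_family_on I {..<K}"
  proof -
    \<comment> \<open>The number of the block can be read off from any of its indices.\<close>
    have "(case_sum id id x - 1) div 4 = l" if "x \<in> I l" for x l
      using that unfolding I_def by (elim insertE emptyE) (simp_all add: block_index_def)
    then show ?thesis unfolding disjoint_family_on_def by blast
  qed
  moreover have "I l \<subseteq> idx" for l by (simp add: I_def)
  ultimately have ind: "indep_vars (\<lambda>l. PiM (I l) (\<lambda>_. S)) (\<lambda>l \<omega>. \<lambda>i\<in>I l. sample i \<omega>) {..<K}"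
    by (intro indep_vars_restrict[OF indep_sample])
  have D: "D l \<in> borel_measurable (PiM (I l) (\<lambda>_. S))" for l
    unfolding D_def I_def by (intro quad_compose measurable_component_singleton) auto
  have "indep_vars (\<lambda>_. borel) (\<lambda>l \<omega>. D l (\<lambda>i\<in>I l. sample i \<omega>)) {..<K}"
    by (rule indep_vars_compose2[OF ind D])
  also have "(\<lambda>l \<omega>. D l (\<lambda>i\<in>I l. sample i \<omega>)) = block_quad L"
    by (intro ext) (simp add: D_def I_def block_quad_def L)
  finally have "prob (\<Inter>l\<in>{..<K}. block_quad L l -` {0} \<inter> space M) = (\<Prod>l<K. prob (block_quad L l -` {0} \<inter> space M))"
    using assms by (intro indep_varsD_finite) auto
  moreover have "(\<Inter>l\<in>{..<K}. block_quad L l -` {0} \<inter> space M) = {\<omega> \<in> space M. \<forall>l<K. block_quad L l \<omega> = 0}"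
    using assms by auto
  moreover have "block_quad L l -` {0} \<inter> space M = {\<omega> \<in> space M. block_quad L l \<omega> = 0}" for l
    by auto
  ultimately show ?thesis by simp
qed

text \<open>
  All \<open>K\<close> independent contrasts would have to vanish, which has probability at most
  \<open>(1 - \<pi>) ^ K \<le> exp (- K \<pi>) \<le> 1 / (K \<pi>)\<close>.
\<close>

lemma prob_var_est_zero_le:
  assumes K: "0 < K" "4 * K \<le> n" "4 * K \<le> m"
    and \<pi>: "0 < \<pi>" "\<And>l. \<pi> \<le> \<P>(\<omega> in M. block_quad L l \<omega> \<noteq> 0)"
  shows "\<P>(\<omega> in M. var_est n m \<omega> = 0) \<le> 1 / (real K * \<pi>)"
proof -
  have each: "\<P>(\<omega> in M. block_quad L l \<omega> = 0) \<le> 1 - \<pi>" for l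
    using \<pi>(2)[of l] prob_neg[of "\<lambda>\<omega>. block_quad L l \<omega> = 0"] by simp
  have "\<P>(\<omega> in M. var_est n m \<omega> = 0) \<le> \<P>(\<omega> in M. \<forall>l<K. block_quad L l \<omega> = 0)"
    using block_quad_eq_0_if_var_est_eq_0[OF _ K(2,3), where L = L] by (intro finite_measure_mono) auto
  also have "\<dots> \<le> (\<Prod>l<K. 1 - \<pi>)"
    unfolding prob_all_blocks_zero[OF K(1)] using each by (intro prod_mono) auto
  also have "\<dots> \<le> (\<Prod>l<K. exp (- \<pi>))"
  proof (intro prod_mono conjI)
    show "0 \<le> 1 - \<pi>" using each[of 0] order_trans[OF measure_nonneg] by blast
    show "1 - \<pi> \<le> exp (- \<pi>)" using exp_ge_add_one_self[of "- \<pi>"] by simp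
  qed
  also have "\<dots> = inverse (exp (real K * \<pi>))"
    by (simp add: exp_minus[symmetric] exp_of_nat_mult[symmetric])
  also have "\<dots> \<le> inverse (real K * \<pi>)"
    using K \<pi>(1) exp_ge_add_one_self[of "real K * \<pi>"]
    by (intro le_imp_inverse_le) (auto simp: add_increasing2 intro: order_trans[OF _ exp_ge_add_one_self])
  finally show ?thesis by (simp add: field_simps)
qed

text \<open>
  Markov's inequality for the dominating average \<open>G\<close> of squared contrasts. The constant is
  \<open>12 = 4 * 3\<close>, where \<open>3\<close> bounds \<open>(N - 1) / (N - 3)\<close> for \<open>N \<ge> 4\<close>.
\<close>

lemma prob_var_est_ge_le:
  assumes N: "4 \<le> n + m" and x: "0 < x"
  shows "\<P>(\<omega> in M. x \<le> var_est n m \<omega>) \<le> 12 * V2 / (minority ^ 4 * x)"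
proof -
  define N where "N = n + m"
  define J where "J s t = {1..N} - {s, t}" for s t
  have N4: "4 \<le> N" using N by (simp add: N_def)
  have Npos: "real N > 0" "real N - 1 > 0" "real N - 2 > 0" "real N - 3 > 0"
    using N4 by auto
  \<comment> \<open>Bounds every squared centred entry by the average of the squared contrasts through it.\<close>
  define G where "G \<omega> = (\<Sum>s=1..N. \<Sum>t\<in>{1..N} - {s}. \<Sum>i\<in>J s t. \<Sum>j\<in>J s t - {i}. (quad (gram n \<omega>) s t i j)\<^sup>2)
     / (real N * (real N - 3) * ((real N - 2) * (real N - 3)))" for \<omega>
  have quad_int: "integrable M (\<lambda>\<omega>. (quad (gram n \<omega>) s t i j)\<^sup>2)"
    and quad_le: "(\<integral>\<omega>. (quad (gram n \<omega>) s t i j)\<^sup>2 \<partial>M) \<le> 4 * V2 / minority ^ 4"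
    if "s \<in> {1..N}" "t \<in> {1..N} - {s}" "i \<in> J s t" "j \<in> J s t - {i}" for s t i j
  proof -
    have "{pooled_index n s, pooled_index n t, pooled_index n i, pooled_index n j} \<subseteq> idx"
      "distinct [pooled_index n s, pooled_index n t, pooled_index n i, pooled_index n j]"
      using that by (auto simp: J_def)
    then show "integrable M (\<lambda>\<omega>. (quad (gram n \<omega>) s t i j)\<^sup>2)"
      "(\<integral>\<omega>. (quad (gram n \<omega>) s t i j)\<^sup>2 \<partial>M) \<le> 4 * V2 / minority ^ 4"
      unfolding quad_gram by (rule integrable_quad_sample_square expectation_quad_sample_square_le)+
  qed
  have intG: "integrable M G"
    unfolding G_def using quad_int by (intro integrable_divide Bochner_Integration.integrable_sum) auto
  have G_nonneg: "0 \<le> G \<omega>" for \<omega>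
    unfolding G_def using Npos by (intro divide_nonneg_nonneg sum_nonneg) auto
  have var_le: "var_est n m \<omega> \<le> G \<omega>" if \<omega>: "\<omega> \<in> space M" for \<omega>
  proof -
    interpret symmetric_array N "gram n \<omega>" a0
      by (rule symmetric_array_gram[OF \<omega> N4])
    have "(offdiag_centered s t)\<^sup>2 \<le>
        (\<Sum>i\<in>J s t. \<Sum>j\<in>J s t - {i}. (quad (gram n \<omega>) s t i j)\<^sup>2) / ((real N - 2) * (real N - 3))"
      if "s \<in> {1..N}" "t \<in> {1..N} - {s}" for s t
      using offdiag_centered_square_le[of s t] that Npos
      by (subst pos_le_divide_eq) (auto simp: J_def mult.commute intro!: mult_pos_pos)
    then have "var_est n m \<omega> \<le> 1 / (real N * (real N - 3)) *
       (\<Sum>s=1..N. \<Sum>t\<in>{1..N} - {s}.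
         (\<Sum>i\<in>J s t. \<Sum>j\<in>J s t - {i}. (quad (gram n \<omega>) s t i j)\<^sup>2) / ((real N - 2) * (real N - 3)))"
      unfolding var_est_eq[OF \<omega> N] N_def[symmetric] using Npos
      by (intro mult_left_mono sum_mono) auto
    also have "\<dots> = G \<omega>" by (simp add: G_def sum_divide_distrib[symmetric])
    finally show ?thesis .
  qed
  have cardJ: "real (card (J s t)) = real N - 2" "finite (J s t)" if "s \<in> {1..N}" "t \<in> {1..N} - {s}" for s t
    using that N4 by (auto simp: J_def card_Diff_subset of_nat_diff)
  have "(\<integral>\<omega>. G \<omega> \<partial>M) = (\<Sum>s=1..N. \<Sum>t\<in>{1..N} - {s}. \<Sum>i\<in>J s t. \<Sum>j\<in>J s t - {i}. 
       (\<integral>\<omega>. (quad (gram n \<omega>) s t i j)\<^sup>2 \<partial>M)) / (real N * (real N - 3) * ((real N - 2) * (real N - 3)))"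
    unfolding G_def integral_divide_zero
    by (intro arg_cong2[where f = "(/)"] trans[OF Bochner_Integration.integral_sum] sum.cong refl
        Bochner_Integration.integrable_sum quad_int)
  also have "\<dots> \<le> (\<Sum>s=1..N. \<Sum>t\<in>{1..N} - {s}. \<Sum>i\<in>J s t. \<Sum>j\<in>J s t - {i}. 4 * V2 / minority ^ 4)
      / (real N * (real N - 3) * ((real N - 2) * (real N - 3)))"
    using quad_le Npos by (intro divide_right_mono sum_mono) auto
  also have "(\<Sum>s=1..N. \<Sum>t\<in>{1..N} - {s}. \<Sum>i\<in>J s t. \<Sum>j\<in>J s t - {i}. 4 * V2 / minority ^ 4) =
     (\<Sum>s=1..N. \<Sum>t\<in>{1..N} - {s}. (real N - 2) * ((real N - 3) * (4 * V2 / minority ^ 4)))"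
  proof (intro sum.cong refl)
    fix s t assume st: "s \<in> {1..N}" "t \<in> {1..N} - {s}"
    have "real (card (J s t - {i})) = real N - 3" if "i \<in> J s t" for i
      using that cardJ[OF st] N4 by (simp add: of_nat_diff card_Diff_singleton) 
    then have "(\<Sum>i\<in>J s t. \<Sum>j\<in>J s t - {i}. 4 * V2 / minority ^ 4) =
      (\<Sum>i\<in>J s t. (real N - 3) * (4 * V2 / minority ^ 4))" by (intro sum.cong) auto
    then show "(\<Sum>i\<in>J s t. \<Sum>j\<in>J s t - {i}. 4 * V2 / minority ^ 4) = (real N - 2) * ((real N - 3) * (4 * V2 / minority ^ 4))"
      using cardJ(1)[OF st] by simp
  qed
  also have "\<dots> = real N * ((real N - 1) * ((real N - 2) * ((real N - 3) * (4 * V2 / minority ^ 4))))"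
    using N4 by (simp add: of_nat_diff)
  also have "\<dots> / (real N * (real N - 3) * ((real N - 2) * (real N - 3))) =
      (real N - 1) / (real N - 3) * (4 * V2 / minority ^ 4)"
    using Npos by simp
  also have "\<dots> \<le> 3 * (4 * V2 / minority ^ 4)"
    using Npos N4 V2_nonneg minority by (intro mult_right_mono) (auto simp: field_simps)
  finally have EG: "(\<integral>\<omega>. G \<omega> \<partial>M) \<le> 12 * V2 / minority ^ 4" by simp
  have [measurable]: "G \<in> borel_measurable M" using intG by auto
  have "\<P>(\<omega> in M. x \<le> var_est n m \<omega>) \<le> \<P>(\<omega> in M. x \<le> G \<omega>)"
    using var_le by (intro finite_measure_mono) (auto intro: order_trans)
  also have "\<dots> \<le> (\<integral>\<omega>. G \<omega> \<partial>M) / x"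
    using intG G_nonneg x by (intro integral_Markov_inequality_measure[where A = "{}"]) auto
  also have "\<dots> \<le> (12 * V2 / minority ^ 4) / x"
    using EG x by (intro divide_right_mono) auto
  finally show ?thesis by simp
qed

end

section \<open>The energy statistic as a U-statistic\<close>

definition off_diag :: "nat \<Rightarrow> (nat \<times> nat) set" where
  "off_diag n = (SIGMA i:{1..n}. {1..n} - {i})"

lemma finite_off_diag[simp]: "finite (off_diag n)"
  by (simp add: off_diag_def)

lemma card_off_diag: "1 \<le> n \<Longrightarrow> real (card (off_diag n)) = real n * (real n - 1)"
  by (simp add: off_diag_def card_SigmaI of_nat_diff)

lemma mem_off_diag: "(i, j) \<in> off_diag n \<longleftrightarrow> 1 \<le> i \<and> i \<le> n \<and> 1 \<le> j \<and> j \<le> n \<and> i \<noteq> j"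
  by (auto simp: off_diag_def)

lemma card_off_diag_touching:
  assumes "a \<in> {1..n}" "b \<in> {1..n}"
  shows "real (card {(i, j) \<in> off_diag n. i \<in> {a, b} \<or> j \<in> {a, b}}) \<le> 4 * (real n - 1)"
proof -
  define T where "T c = {c} \<times> ({1..n} - {c}) \<union> ({1..n} - {c}) \<times> {c}" for c
  have T: "card (T c) \<le> 2 * (n - 1)" "finite (T c)" if "c \<in> {1..n}" for c
    using that card_Un_le[of "{c} \<times> ({1..n} - {c})" "({1..n} - {c}) \<times> {c}"]
    by (auto simp: T_def card_cartesian_product)
  have "{(i, j) \<in> off_diag n. i \<in> {a, b} \<or> j \<in> {a, b}} \<subseteq> T a \<union> T b"
    by (auto simp: T_def mem_off_diag)
  then have "card {(i, j) \<in> off_diag n. i \<in> {a, b} \<or> j \<in> {a, b}} \<le> card (T a \<union> T b)"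
    using T assms by (intro card_mono) auto
  also have "\<dots> \<le> card (T a) + card (T b)" by (rule card_Un_le)
  also have "\<dots> \<le> 4 * (n - 1)" using T(1)[OF assms(1)] T(1)[OF assms(2)] by simp
  finally have "card {(i, j) \<in> off_diag n. i \<in> {a, b} \<or> j \<in> {a, b}} \<le> 4 * (n - 1)" .
  from of_nat_mono[OF this, where 'a = real] show ?thesis
    using assms by (simp add: of_nat_diff)
qed

lemma sum_off_diag: "sum f (off_diag n) = (\<Sum>i=1..n. \<Sum>j\<in>{1..n} - {i}. f (i, j))"
  by (simp add: off_diag_def sum.Sigma)

lemma sum_off_diag_fst: "(\<Sum>(i, j)\<in>off_diag n. f i) = (real n - 1) * (\<Sum>i=1..n. f i)" for f :: "nat \<Rightarrow> real"
  unfolding sum_off_diag by (auto simp: sum_distrib_left of_nat_diff intro!: sum.cong)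

lemma sum_off_diag_swap: "(\<Sum>(i, j)\<in>off_diag n. f i j) = (\<Sum>(i, j)\<in>off_diag n. f j i)" for f :: "nat \<Rightarrow> nat \<Rightarrow> real"
  by (rule sum.reindex_bij_witness[of _ prod.swap prod.swap]) (auto simp: mem_off_diag)

lemma sum_off_diag_symmetric:
  fixes g :: "nat \<Rightarrow> nat \<Rightarrow> real"
  assumes "\<And>i j. \<lbrakk>i \<in> {1..n}; j \<in> {1..n}\<rbrakk> \<Longrightarrow> g i j = g j i"
  shows "(\<Sum>(i, j)\<in>off_diag n. g i j) = 2 * (\<Sum>j=1..n. \<Sum>i=1..<j. g i j)"
proof -
  have "(\<Sum>(i, j)\<in>off_diag n. g i j) = (\<Sum>(i, j)\<in>(SIGMA j:{1..n}. {1..<j}). g i j)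
     + (\<Sum>(i, j)\<in>(SIGMA j:{1..n}. {j<..n}). g i j)"
    by (subst sum.union_disjoint[symmetric]) (auto simp: mem_off_diag intro!: sum.cong)
  also have "(\<Sum>(i, j)\<in>(SIGMA j:{1..n}. {j<..n}). g i j) = (\<Sum>(j, i)\<in>(SIGMA j:{1..n}. {1..<j}). g i j)"
    by (rule sum.reindex_bij_witness[of _ prod.swap prod.swap]) auto
  also have "(\<Sum>(i, j)\<in>(SIGMA j:{1..n}. {1..<j}). g i j) = (\<Sum>(j, i)\<in>(SIGMA j:{1..n}. {1..<j}). g i j)"
    using assms by (intro sum.cong refl) auto
  finally show ?thesis by (simp add: sum.Sigma)
qed

text \<open>
  Averaging \<open>h\<close> over ordered pairs turns each of the four cross terms into the mean of
  \<open>k (x i) (y j)\<close>, and each of the other two into a mean over unordered pairs because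
  \<open>k\<close> is symmetric on the sample.
\<close>

lemma energy_stat_eq_sum_h:
  assumes nm: "2 \<le> n" "2 \<le> m"
    and x: "\<And>i j. \<lbrakk>i \<in> {1..n}; j \<in> {1..n}\<rbrakk> \<Longrightarrow> k (x i) (x j) = k (x j) (x i)"
    and y: "\<And>i j. \<lbrakk>i \<in> {1..m}; j \<in> {1..m}\<rbrakk> \<Longrightarrow> k (y i) (y j) = k (y j) (y i)"
  shows "energy_stat k n m x y =
    (\<Sum>((i, i'), (j, j'))\<in>off_diag n \<times> off_diag m. h_kernel k (x i) (x i') (y j) (y j'))
     / (real n * (real n - 1) * (real m * (real m - 1)))"
proof -
  define s where "s = (\<Sum>i=1..n. \<Sum>j=1..m. k (x i) (y j))"
  define sx where "sx = (\<Sum>j=1..n. \<Sum>i=1..<j. k (x i) (x j))"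
  define sy where "sy = (\<Sum>j=1..m. \<Sum>i=1..<j. k (y i) (y j))"
  have pos: "real n > 0" "real n - 1 > 0" "real m > 0" "real m - 1 > 0" using nm by auto
  have f: "(\<Sum>(i, i')\<in>off_diag n. f i) = (real n - 1) * (\<Sum>i=1..n. f i)"
    "(\<Sum>(i, i')\<in>off_diag n. f i') = (real n - 1) * (\<Sum>i=1..n. f i)" for n and f :: "nat \<Rightarrow> real"
    using sum_off_diag_fst sum_off_diag_swap[of "\<lambda>i j. f j"] by simp_all
  have pair_x: "(\<Sum>(i, j)\<in>off_diag n. k (x i) (x j)) = 2 * sx"
    unfolding sx_def by (rule sum_off_diag_symmetric) (rule x)
  have pair_y: "(\<Sum>(i, j)\<in>off_diag m. k (y i) (y j)) = 2 * sy"
    unfolding sy_def by (rule sum_off_diag_symmetric) (rule y)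
  have in_y: "(\<Sum>(j, j')\<in>off_diag m. h_kernel k (x i) (x i') (y j) (y j')) =
     (real m - 1) * ((\<Sum>j=1..m. k (x i) (y j)) + (\<Sum>j=1..m. k (x i') (y j)))
     - real m * (real m - 1) * k (x i) (x i') - 2 * sy" for i i'
  proof -
    have "(\<Sum>(j, j')\<in>off_diag m. h_kernel k (x i) (x i') (y j) (y j')) =
       1 / 2 * ((\<Sum>(j, j')\<in>off_diag m. k (x i) (y j)) + (\<Sum>(j, j')\<in>off_diag m. k (x i) (y j'))
       + (\<Sum>(j, j')\<in>off_diag m. k (x i') (y j)) + (\<Sum>(j, j')\<in>off_diag m. k (x i') (y j')))
       - (\<Sum>(j, j')\<in>off_diag m. k (x i) (x i')) - (\<Sum>(j, j')\<in>off_diag m. k (y j) (y j'))"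
      unfolding h_kernel_def by (simp add: case_prod_beta sum.distrib sum_subtractf sum_distrib_left sum_divide_distrib add_divide_distrib)
    also have "\<dots> = (real m - 1) * ((\<Sum>j=1..m. k (x i) (y j)) + (\<Sum>j=1..m. k (x i') (y j)))
     - real m * (real m - 1) * k (x i) (x i') - 2 * sy"
      using nm by (simp add: f pair_y card_off_diag) (simp add: field_simps)
    finally show ?thesis .
  qed
  have "(\<Sum>((i, i'), (j, j'))\<in>off_diag n \<times> off_diag m. h_kernel k (x i) (x i') (y j) (y j')) =
    (\<Sum>(i, i')\<in>off_diag n. \<Sum>(j, j')\<in>off_diag m. h_kernel k (x i) (x i') (y j) (y j'))"
    by (simp add: sum.cartesian_product' case_prod_beta)
  also have "\<dots> = (real m - 1) * ((\<Sum>(i, i')\<in>off_diag n. \<Sum>j=1..m. k (x i) (y j)) +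
      (\<Sum>(i, i')\<in>off_diag n. \<Sum>j=1..m. k (x i') (y j)))
      - real m * (real m - 1) * (\<Sum>(i, i')\<in>off_diag n. k (x i) (x i')) - (\<Sum>(i, i')\<in>off_diag n. 2 * sy)"
    unfolding in_y
    by (simp add: case_prod_beta sum.distrib sum_subtractf distrib_left flip: sum_distrib_left)
  also have "\<dots> = 2 * (real m - 1) * (real n - 1) * s - real m * (real m - 1) * (2 * sx)
      - real n * (real n - 1) * (2 * sy)"
    using nm by (simp add: f pair_x s_def card_off_diag)
  finally have main: "(\<Sum>((i, i'), (j, j'))\<in>off_diag n \<times> off_diag m. h_kernel k (x i) (x i') (y j) (y j')) = \<dots>" .
  have ch: "real (n choose 2) = real n * (real n - 1) / 2" for n
    by (cases n) (simp_all add: choose_two real_of_nat_div algebra_simps)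
  show ?thesis
    unfolding main energy_stat_def ch s_def[symmetric] sx_def[symmetric] sy_def[symmetric]
    using pos by (simp add: divide_simps) (simp add: algebra_simps)
qed

context energy_model
begin

definition energy_est :: "nat \<Rightarrow> nat \<Rightarrow> 'a \<Rightarrow> real" where
  "energy_est n m \<omega> = energy_stat k n m (\<lambda>i. X i \<omega>) (\<lambda>j. Y j \<omega>)"

definition h_moment :: real where
  "h_moment = (\<integral>\<omega>. (h_kernel k (X 1 \<omega>) (X 2 \<omega>) (Y 1 \<omega>) (Y 2 \<omega>))\<^sup>2 \<partial>M)"

definition h_at :: "(nat \<times> nat) \<times> nat \<times> nat \<Rightarrow> 'a \<Rightarrow> real" where
  "h_at q \<omega> = (case q of ((i, i'), (j, j')) \<Rightarrow> h_kernel k (X i \<omega>) (X i' \<omega>) (Y j \<omega>) (Y j' \<omega>))"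

lemma h_at_sample: "h_at ((i, i'), (j, j')) \<omega> =
    h_kernel k (sample (Inl i) \<omega>) (sample (Inl i') \<omega>) (sample (Inr j) \<omega>) (sample (Inr j') \<omega>)"
  by (simp add: h_at_def sample_def)

context
  fixes i i' j j' :: nat
  assumes ij: "1 \<le> i" "1 \<le> i'" "i \<noteq> i'" "1 \<le> j" "1 \<le> j'" "j \<noteq> j'"
begin

lemma h_at_measurable: "h_at ((i, i'), (j, j')) \<in> borel_measurable M"
  unfolding h_at_sample using ij by auto

lemma integrable_h_at_square: "integrable M (\<lambda>\<omega>. (h_at ((i, i'), (j, j')) \<omega>)\<^sup>2)"
proof -
  have half: "integrable M (\<lambda>\<omega>. (1 / 2 * f \<omega>)\<^sup>2)" if "integrable M (\<lambda>\<omega>. (f \<omega>)\<^sup>2)" for f :: "'a \<Rightarrow> real"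
    using that by (simp add: power_divide)
  show ?thesis
    unfolding h_at_sample h_kernel_def using ij
    by (intro square_integrable_sum half integrable_kernel_sample_square) auto
qed

lemma expectation_h_at: "(\<integral>\<omega>. h_at ((i, i'), (j, j')) \<omega> \<partial>M) = En"
  unfolding h_at_sample h_kernel_def using ij
  by (simp add: integrable_kernel_sample expectation_kernel_sample kmean_def energy_dist_def)

lemma expectation_h_at_square: "(\<integral>\<omega>. (h_at ((i, i'), (j, j')) \<omega>)\<^sup>2 \<partial>M) = h_moment"
proof -
  have m: "(\<lambda>(w, x, y, z). (h_kernel k w x y z)\<^sup>2) \<in> borel_measurable S4" by measurable
  show ?thesis
    using expectation_sample_four[OF _ _ m, of "Inl i" "Inl i'" "Inr j" "Inr j'"]
      expectation_sample_four[OF _ _ m, of "Inl 1" "Inl 2" "Inr 1" "Inr 2"] ij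
    by (simp add: h_at_sample h_moment_def) (simp add: sample_def)
qed

lemma expectation_h_at_variance: "(\<integral>\<omega>. (h_at ((i, i'), (j, j')) \<omega> - En)\<^sup>2 \<partial>M) \<le> h_moment"
proof -
  have "integrable M (h_at ((i, i'), (j, j')))"
    by (rule square_integrable_imp_integrable[OF h_at_measurable integrable_h_at_square])
  then have "(\<integral>\<omega>. (h_at ((i, i'), (j, j')) \<omega> - En)\<^sup>2 \<partial>M) = h_moment - En\<^sup>2"
    using variance_eq[OF _ integrable_h_at_square] expectation_h_at expectation_h_at_square by simp
  then show ?thesis by simp
qed

end

lemma expectation_h_at_disjoint:
  assumes "1 \<le> i" "1 \<le> i'" "i \<noteq> i'" "1 \<le> j" "1 \<le> j'" "j \<noteq> j'"
    and "1 \<le> l" "1 \<le> l'" "l \<noteq> l'" "1 \<le> r" "1 \<le> r'" "r \<noteq> r'"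
    and disj: "{i, i'} \<inter> {l, l'} = {}" "{j, j'} \<inter> {r, r'} = {}"
  shows "(\<integral>\<omega>. (h_at ((i, i'), (j, j')) \<omega> - En) * (h_at ((l, l'), (r, r')) \<omega> - En) \<partial>M) = 0"
proof -
  let ?A = "{Inl i, Inl i', Inr j, Inr j'}" and ?B = "{Inl l, Inl l', Inr r, Inr r'}"
  let ?f = "\<lambda>x. h_kernel k (x (Inl i)) (x (Inl i')) (x (Inr j)) (x (Inr j')) - En"
  let ?g = "\<lambda>x. h_kernel k (x (Inl l)) (x (Inl l')) (x (Inr r)) (x (Inr r')) - En"
  have "indep_var borel (\<lambda>\<omega>. ?f (\<lambda>a\<in>?A. sample a \<omega>)) borel (\<lambda>\<omega>. ?g (\<lambda>a\<in>?B. sample a \<omega>))"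
    using assms
    by (intro indep_var_of_disjoint[OF indep_sample] borel_measurable_diff borel_measurable_const
        h_compose measurable_component_singleton) auto
  then have iv: "indep_var borel (\<lambda>\<omega>. h_at ((i, i'), (j, j')) \<omega> - En) borel (\<lambda>\<omega>. h_at ((l, l'), (r, r')) \<omega> - En)"
    by (simp add: h_at_sample)
  have int: "integrable M (h_at ((i, i'), (j, j')))" if "1 \<le> i" "1 \<le> i'" "i \<noteq> i'" "1 \<le> j" "1 \<le> j'" "j \<noteq> j'" for i i' j j'
    using that by (intro square_integrable_imp_integrable[OF h_at_measurable integrable_h_at_square])
  show ?thesis
    by (subst indep_var_lebesgue_integral[OF iv]) (use assms int expectation_h_at in \<open>simp_all add: prob_space\<close>)
qed

lemma energy_est_eq:
  assumes "\<omega> \<in> space M" "2 \<le> n" "2 \<le> m"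
  shows "energy_est n m \<omega> = (\<Sum>q\<in>off_diag n \<times> off_diag m. h_at q \<omega>)
     / (real n * (real n - 1) * (real m * (real m - 1)))"
proof -
  have "X i \<omega> \<in> space S" "Y i \<omega> \<in> space S" if "1 \<le> i" for i
    using that assms(1) X_measurable Y_measurable measurable_space by metis+
  then show ?thesis
    unfolding energy_est_def h_at_def using assms(2,3)
    by (subst energy_stat_eq_sum_h) (auto simp: case_prod_beta intro!: kernel_sym)
qed

lemma energy_est_measurable[measurable]: "energy_est n m \<in> borel_measurable M"
proof -
  have "(\<lambda>\<omega>. energy_est n m \<omega>) \<in> borel_measurable M"
    unfolding energy_est_def energy_stat_def
    by (intro borel_measurable_diff borel_measurable_times borel_measurable_const borel_measurable_sum
        kernel_compose X_measurable Y_measurable) auto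
  then show ?thesis by simp
qed

text \<open>
  Chebyshev's inequality. A term of the U-statistic shares an observation with at most a fraction
  \<open>4 / n + 4 / m\<close> of all terms (\<open>d / c\<close> in the proof), and a deviation of half the mean
  costs another factor \<open>4\<close>.
\<close>

lemma prob_energy_est_deviation_le:
  assumes nm: "2 \<le> n" "2 \<le> m" and pos: "0 < En"
  shows "\<P>(\<omega> in M. energy_est n m \<omega> \<le> En / 2) \<le> 16 * (1 / real n + 1 / real m) * h_moment / En\<^sup>2"
proof -
  define Q where "Q = off_diag n \<times> off_diag m"
  define c where "c = real n * (real n - 1) * (real m * (real m - 1))"
  define d where "d = 4 * (real n - 1) * (real m * (real m - 1)) + real n * (real n - 1) * (4 * (real m - 1))"
  have pos_nm: "real n > 0" "real n - 1 > 0" "real m > 0" "real m - 1 > 0" using nm by auto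
  have cpos: "c > 0" using pos_nm by (simp add: c_def)
  have finQ: "finite Q" by (simp add: Q_def)
  have cardQ: "real (card Q) = c"
    using nm by (simp add: Q_def c_def card_cartesian_product card_off_diag)
  define R :: "(nat \<times> nat) \<times> (nat \<times> nat) \<Rightarrow> _ \<Rightarrow> bool" where
    "R q r = (case (q, r) of (((i, i'), (j, j')), ((l, l'), (r, r'))) \<Rightarrow>
       l \<in> {i, i'} \<or> l' \<in> {i, i'} \<or> r \<in> {j, j'} \<or> r' \<in> {j, j'})" for q r
  have overlap: "real (card {r \<in> Q. R q r}) \<le> d" if "q \<in> Q" for q
  proof -
    obtain i i' j j' where q: "q = ((i, i'), (j, j'))" by (cases q) auto
    let ?Tn = "{(l, l') \<in> off_diag n. l \<in> {i, i'} \<or> l' \<in> {i, i'}}"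
    let ?Tm = "{(l, l') \<in> off_diag m. l \<in> {j, j'} \<or> l' \<in> {j, j'}}"
    have fin: "finite ?Tn" "finite ?Tm"
      by (rule finite_subset[OF _ finite_off_diag]; auto)+
    have "{r \<in> Q. R q r} \<subseteq> ?Tn \<times> off_diag m \<union> off_diag n \<times> ?Tm"
      unfolding Q_def R_def q by auto
    then have "card {r \<in> Q. R q r} \<le> card (?Tn \<times> off_diag m \<union> off_diag n \<times> ?Tm)"
      using fin by (intro card_mono) simp_all
    also have "\<dots> \<le> card (?Tn \<times> off_diag m) + card (off_diag n \<times> ?Tm)" by (rule card_Un_le)
    finally have "card {r \<in> Q. R q r} \<le> card ?Tn * card (off_diag m) + card (off_diag n) * card ?Tm"
      by (simp only: card_cartesian_product)
    then have "real (card {r \<in> Q. R q r}) \<le>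
       real (card ?Tn) * real (card (off_diag m)) + real (card (off_diag n)) * real (card ?Tm)"
      by (simp only: of_nat_le_iff of_nat_add[symmetric] of_nat_mult[symmetric])
    also have "\<dots> \<le> d"
      unfolding d_def using that nm card_off_diag[of n] card_off_diag[of m]
      by (intro add_mono mult_mono card_off_diag_touching) (auto simp: Q_def q mem_off_diag)
    finally show ?thesis .
  qed
  define f where "f q \<omega> = h_at q \<omega> - En" for q \<omega>
  have f_meas: "f q \<in> borel_measurable M" and f_int: "integrable M (\<lambda>\<omega>. (f q \<omega>)\<^sup>2)"
    and f_var: "(\<integral>\<omega>. (f q \<omega>)\<^sup>2 \<partial>M) \<le> h_moment" if "q \<in> Q" for q
  proof -
    obtain i i' j j' where q: "q = ((i, i'), (j, j'))" by (cases q) auto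
    have ij: "1 \<le> i" "1 \<le> i'" "i \<noteq> i'" "1 \<le> j" "1 \<le> j'" "j \<noteq> j'"
      using that by (auto simp: Q_def q mem_off_diag)
    note [measurable] = h_at_measurable[OF ij]
    show "f q \<in> borel_measurable M" unfolding f_def q by measurable
    show "integrable M (\<lambda>\<omega>. (f q \<omega>)\<^sup>2)"
      unfolding f_def q by (intro square_integrable_sum integrable_h_at_square[OF ij]) auto
    show "(\<integral>\<omega>. (f q \<omega>)\<^sup>2 \<partial>M) \<le> h_moment"
      unfolding f_def q by (rule expectation_h_at_variance[OF ij])
  qed
  have f_cov: "(\<integral>\<omega>. f q \<omega> * f r \<omega> \<partial>M) = 0" if "q \<in> Q" "r \<in> Q" "\<not> R q r" for q r
    using that unfolding f_def Q_def
    by (cases q; cases r) (auto simp: R_def mem_off_diag intro!: expectation_h_at_disjoint)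
  have h0: "0 \<le> h_moment" unfolding h_moment_def by simp
  note bound = expectation_square_sum_le[OF finQ f_meas f_int f_var f_cov overlap h0]
  have est: "energy_est n m \<omega> - En = (\<Sum>q\<in>Q. f q \<omega>) / c" if "\<omega> \<in> space M" for \<omega>
    unfolding energy_est_eq[OF that nm] c_def[symmetric] Q_def[symmetric] f_def
    using cpos cardQ by (simp add: sum_subtractf field_simps)
  have [measurable]: "(\<lambda>\<omega>. \<Sum>q\<in>Q. f q \<omega>) \<in> borel_measurable M"
    by (intro borel_measurable_sum f_meas)
  have "\<P>(\<omega> in M. energy_est n m \<omega> \<le> En / 2) \<le> \<P>(\<omega> in M. c * (En / 2) \<le> \<bar>\<Sum>q\<in>Q. f q \<omega>\<bar>)"
  proof (intro finite_measure_mono subsetI)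
    fix \<omega> assume "\<omega> \<in> {\<omega> \<in> space M. energy_est n m \<omega> \<le> En / 2}"
    then have \<omega>: "\<omega> \<in> space M" and "energy_est n m \<omega> - En \<le> - (En / 2)" by auto
    then have "(\<Sum>q\<in>Q. f q \<omega>) \<le> - (c * (En / 2))"
      unfolding est[OF \<omega>] using cpos by (simp add: field_simps)
    then show "\<omega> \<in> {\<omega> \<in> space M. c * (En / 2) \<le> \<bar>\<Sum>q\<in>Q. f q \<omega>\<bar>}"
      using \<omega> by simp
  qed simp
  also have "\<dots> \<le> (\<integral>\<omega>. (\<Sum>q\<in>Q. f q \<omega>)\<^sup>2 \<partial>M) / (c * (En / 2))\<^sup>2"
    using bound(1) cpos pos by (intro second_moment_method) auto
  also have "\<dots> \<le> (c * d * h_moment) / (c * (En / 2))\<^sup>2"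
    using bound(2) unfolding cardQ by (intro divide_right_mono) auto
  also have "\<dots> = 16 * (1 / real n + 1 / real m) * h_moment / En\<^sup>2"
  proof -
    have "d / c = 4 * (1 / real n + 1 / real m)"
      unfolding d_def c_def using pos_nm by (simp add: divide_simps) (simp add: algebra_simps)
    moreover have "(c * d * h_moment) / (c * (En / 2))\<^sup>2 = 4 * (d / c) * h_moment / En\<^sup>2"
      using cpos pos by (simp add: power2_eq_square field_simps)
    ultimately show ?thesis by simp
  qed
  finally show ?thesis .
qed

end

section \<open>Consistency\<close>

context energy_model
begin

lemma var_est_measurable[measurable]: "var_est n m \<in> borel_measurable M"
proof -
  have "(\<lambda>\<omega>. var_est n m \<omega>) \<in> borel_measurable M"
    unfolding var_est_u_centered u_centered_def
    by (intro borel_measurable_diff borel_measurable_add borel_measurable_times borel_measurable_const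
        borel_measurable_power borel_measurable_sum gram_measurable) auto
  then show ?thesis by simp
qed

text \<open>
  Outside the three events \<open>B1\<close> (numerator too small), \<open>B2\<close> (variance estimator zero)
  and \<open>B3\<close> (variance estimator too large) the statistic exceeds \<open>C\<close>.
\<close>

lemma prob_T_stat_gt_ge:
  assumes nm: "4 \<le> n" "4 \<le> m" and K: "0 < K" "4 * K \<le> n" "4 * K \<le> m"
    and pos: "0 < V2" "0 < En" "0 < R" "0 < C" "0 < \<pi>"
    and \<pi>: "\<And>l. \<pi> \<le> \<P>(\<omega> in M. block_quad L l \<omega> \<noteq> 0)"
    and small: "C\<^sup>2 * (c_norm n m * (R * V2)) \<le> (En / 2)\<^sup>2"
  shows "1 - 16 * (1 / real n + 1 / real m) * h_moment / En\<^sup>2 - 1 / (real K * \<pi>) - 12 / (minority ^ 4 * R)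
    \<le> \<P>(\<omega> in M. T_stat k a0 n m (\<lambda>i. X i \<omega>) (\<lambda>j. Y j \<omega>) > C)"
proof -
  let ?T = "\<lambda>\<omega>. T_stat k a0 n m (\<lambda>i. X i \<omega>) (\<lambda>j. Y j \<omega>)"
  define B1 where "B1 = {\<omega> \<in> space M. energy_est n m \<omega> \<le> En / 2}"
  define B2 where "B2 = {\<omega> \<in> space M. var_est n m \<omega> = 0}"
  define B3 where "B3 = {\<omega> \<in> space M. R * V2 \<le> var_est n m \<omega>}"
  have T: "?T \<omega> = energy_est n m \<omega> / sqrt (c_norm n m * var_est n m \<omega>)" for \<omega>
    by (simp add: T_stat_def energy_est_def var_est_def)
  have T_meas: "{\<omega> \<in> space M. C < ?T \<omega>} \<in> events"
    unfolding T by measurable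
  have [measurable]: "B1 \<in> events" "B2 \<in> events" "B3 \<in> events"
    unfolding B1_def B2_def B3_def by measurable
  have c: "0 < c_norm n m"
    unfolding c_norm_def using nm by (intro add_pos_pos divide_pos_pos mult_pos_pos) auto
  have "space M - (B1 \<union> B2 \<union> B3) \<subseteq> {\<omega> \<in> space M. C < ?T \<omega>}"
  proof
    fix \<omega> assume "\<omega> \<in> space M - (B1 \<union> B2 \<union> B3)"
    then have \<omega>: "\<omega> \<in> space M" and e: "En / 2 < energy_est n m \<omega>"
      and v: "var_est n m \<omega> \<noteq> 0" "var_est n m \<omega> < R * V2"
      by (auto simp: B1_def B2_def B3_def)
    have v0: "0 < var_est n m \<omega>" using v(1) var_est_nonneg[OF \<omega>, of n m] nm by simp
    have "(C * sqrt (c_norm n m * var_est n m \<omega>))\<^sup>2 = C\<^sup>2 * (c_norm n m * var_est n m \<omega>)"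
      unfolding power_mult_distrib using c v0 by (subst real_sqrt_pow2) simp_all
    also have "\<dots> \<le> C\<^sup>2 * (c_norm n m * (R * V2))"
      using c v(2) by (intro mult_left_mono) simp_all
    also have "\<dots> \<le> (En / 2)\<^sup>2" by (rule small)
    finally have "C * sqrt (c_norm n m * var_est n m \<omega>) \<le> En / 2"
      by (rule power2_le_imp_le) (use pos in simp)
    then have "C * sqrt (c_norm n m * var_est n m \<omega>) < energy_est n m \<omega>" using e by simp
    then show "\<omega> \<in> {\<omega> \<in> space M. C < ?T \<omega>}"
      using \<omega> c v0 unfolding T by (simp add: pos_less_divide_eq)
  qed
  then have "prob (space M - (B1 \<union> B2 \<union> B3)) \<le> \<P>(\<omega> in M. C < ?T \<omega>)"
    using T_meas by (rule finite_measure_mono)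
  moreover have "prob (space M - (B1 \<union> B2 \<union> B3)) = 1 - prob (B1 \<union> B2 \<union> B3)"
    by (rule prob_compl) measurable
  moreover have "prob (B1 \<union> B2 \<union> B3) \<le> prob B1 + prob B2 + prob B3"
    using measure_Un_le[of "B1 \<union> B2" M B3] measure_Un_le[of B1 M B2] by simp
  moreover have "prob B1 \<le> 16 * (1 / real n + 1 / real m) * h_moment / En\<^sup>2"
    unfolding B1_def using nm pos by (intro prob_energy_est_deviation_le) auto
  moreover have "prob B2 \<le> 1 / (real K * \<pi>)"
    unfolding B2_def using K pos(5) \<pi> by (rule prob_var_est_zero_le)
  moreover have "prob B3 \<le> 12 / (minority ^ 4 * R)"
    unfolding B3_def using prob_var_est_ge_le[of n m "R * V2"] nm pos by simp
  ultimately show ?thesis by linarith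
qed

text \<open>
  Truncation at level \<open>\<epsilon> N V2\<close>: the tail term then takes at most \<open>3 V2\<close> of the second
  moment \<open>4 V2\<close>, and the rest, \<open>V2\<close>, is at most the level times the probability.
\<close>

lemma exists_block_quad_prob_ge:
  assumes tau: "0 < \<tau>" "\<tau> \<le> 1" and pos: "0 < V2" "0 < N" "0 < \<epsilon>"
    and small: "5 powr (2 + 2 * \<tau>) * (4 * centered_moment (2 + 2 * \<tau>) + \<bar>En\<bar> powr (2 + 2 * \<tau>))
      \<le> 3 * \<epsilon> powr \<tau> * (N powr \<tau> * V2 powr (1 + \<tau>))"
  shows "\<exists>L. \<forall>l. 1 / (\<epsilon> * N) \<le> \<P>(\<omega> in M. block_quad L l \<omega> \<noteq> 0)"
proof -
  define t where "t = \<epsilon> * N * V2"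
  have t: "0 < t" using pos by (simp add: t_def)
  obtain L where L: "\<And>l. 4 * V2 \<le> (\<integral>\<omega>. (block_quad L l \<omega>)\<^sup>2 \<partial>M)"
    using exists_block_quad_square_ge by blast
  obtain b1 b2 b3 b4 where Lb: "L = (b1, b2, b3, b4)" by (cases L) auto
  have "t powr (- \<tau>) * (5 powr (2 + 2 * \<tau>) * (4 * centered_moment (2 + 2 * \<tau>) + \<bar>En\<bar> powr (2 + 2 * \<tau>)))
     \<le> t powr (- \<tau>) * (3 * \<epsilon> powr \<tau> * (N powr \<tau> * V2 powr (1 + \<tau>)))"
    using small by (intro mult_left_mono) auto
  also have "\<dots> = 3 * V2"
    unfolding t_def using pos by (simp add: powr_mult powr_minus powr_add field_simps)
  finally have tail: "t powr (- \<tau>) * (5 powr (2 + 2 * \<tau>) * (4 * centered_moment (2 + 2 * \<tau>) + \<bar>En\<bar> powr (2 + 2 * \<tau>))) \<le> 3 * V2" .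
  have "1 / (\<epsilon> * N) \<le> \<P>(\<omega> in M. block_quad L l \<omega> \<noteq> 0)" for l
  proof -
    have "(\<integral>\<omega>. (block_quad L l \<omega>)\<^sup>2 \<partial>M) \<le> t * \<P>(\<omega> in M. block_quad L l \<omega> \<noteq> 0) + 3 * V2"
      unfolding block_quad_def Lb prod.case
      by (rule order_trans[OF prob_quad_sample_nonzero[OF _ _ tau t] add_left_mono[OF tail]]) auto
    then have "V2 \<le> t * \<P>(\<omega> in M. block_quad L l \<omega> \<noteq> 0)" using L[of l] by simp
    then show ?thesis using pos unfolding t_def by (simp add: field_simps)
  qed
  then show ?thesis by blast
qed

lemma c_norm_le:
  assumes "0 < w" "2 \<le> n" "2 \<le> m" "w * N \<le> real n" "w * N \<le> real m" "0 < N"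
  shows "c_norm n m \<le> 12 / (w * N)\<^sup>2"
proof -
  have half: "2 / (real a * (real a - 1)) \<le> 4 / (w * N)\<^sup>2" if "2 \<le> a" "w * N \<le> real a" for a
  proof -
    have "(w * N)\<^sup>2 \<le> (real a)\<^sup>2" using that assms by (intro power_mono) auto
    also have "\<dots> \<le> real a * (2 * (real a - 1))"
      unfolding power2_eq_square using that by (intro mult_left_mono) auto
    also have "\<dots> = 2 * (real a * (real a - 1))" by (simp only: mult.left_commute)
    finally have "4 / (2 * (real a * (real a - 1))) \<le> 4 / (w * N)\<^sup>2"
      by (rule divide_left_mono) (use that assms in auto)
    then show ?thesis by simp
  qed
  have "(w * N)\<^sup>2 \<le> real n * real m"
    unfolding power2_eq_square using assms by (intro mult_mono) auto
  then have "4 / (real n * real m) \<le> 4 / (w * N)\<^sup>2"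
    using assms by (intro divide_left_mono mult_pos_pos) auto
  then show ?thesis
    unfolding c_norm_def using half[of n] half[of m] assms by simp
qed

text \<open>
  The three error terms become the quantities that the asymptotic conditions control. The bound
  \<open>B3\<close> uses \<open>R\<close> itself as the factor by which the variance estimator may exceed
  \<open>V2\<close>: with \<open>c_norm n m \<le> 12 / (w N)\<^sup>2\<close> this is affordable once \<open>R\<close> exceeds
  \<open>48 C\<^sup>2 / w\<^sup>2\<close>.
\<close>

lemma prob_T_stat_gt_ge_moments:
  fixes n m :: nat and C \<epsilon> :: real
  defines "N \<equiv> real (n + m)"
  defines "R \<equiv> N * En / sqrt V2"
  defines "w \<equiv> minority / 2"
  assumes nm: "4 \<le> n" "4 \<le> m" "w * N \<le> real n" "w * N \<le> real m"
    and tau: "0 < \<tau>" "\<tau> \<le> 1" and pos: "0 < V2" "0 < \<epsilon>" "0 < C"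
    and small: "5 powr (2 + 2 * \<tau>) * (4 * centered_moment (2 + 2 * \<tau>) + \<bar>En\<bar> powr (2 + 2 * \<tau>))
      \<le> 3 * \<epsilon> powr \<tau> * (N powr \<tau> * V2 powr (1 + \<tau>))"
    and R: "48 * C\<^sup>2 / w\<^sup>2 \<le> R"
  shows "1 - 32 / w * (h_moment / (N * En\<^sup>2)) - 16 / w * \<epsilon> - 12 / minority ^ 4 * (1 / R)
    \<le> \<P>(\<omega> in M. T_stat k a0 n m (\<lambda>i. X i \<omega>) (\<lambda>j. Y j \<omega>) > C)"
proof -
  have w: "0 < w" using minority by (simp add: w_def)
  have N: "0 < N" "w * N > 0" using nm w by (auto simp: N_def)
  have Rpos: "0 < R" using R w pos by (smt (verit) divide_pos_pos zero_less_power mult_pos_pos)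
  then have En: "0 < En" using N pos by (simp add: R_def zero_less_divide_iff zero_less_mult_iff)
  \<comment> \<open>Each block uses four observations of each sample.\<close>
  define K where "K = min n m div 4"
  have K: "0 < K" "4 * K \<le> n" "4 * K \<le> m" using nm by (auto simp: K_def)
  have "min n m \<le> 16 * K" using nm unfolding K_def by linarith
  then have "min (real n) (real m) \<le> 16 * real K" by linarith
  then have KN: "w * N \<le> 16 * real K" using nm by linarith
  obtain L where L: "\<And>l. 1 / (\<epsilon> * N) \<le> \<P>(\<omega> in M. block_quad L l \<omega> \<noteq> 0)"
    using exists_block_quad_prob_ge[OF tau pos(1) N(1) pos(2) small] by blast
  have "C\<^sup>2 * (c_norm n m * (R * V2)) \<le> C\<^sup>2 * (12 / (w * N)\<^sup>2 * (R * V2))"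
    using c_norm_le[OF w _ _ nm(3,4) N(1)] nm Rpos pos by (intro mult_left_mono mult_right_mono) auto
  also have "\<dots> = (48 * C\<^sup>2 / w\<^sup>2) * (R * V2) / (4 * N\<^sup>2)"
    by (simp add: power_mult_distrib field_simps)
  also have "\<dots> \<le> R * (R * V2) / (4 * N\<^sup>2)"
    using R Rpos pos by (intro divide_right_mono mult_right_mono) auto
  also have "\<dots> = (En / 2)\<^sup>2"
    using N pos by (simp add: R_def power2_eq_square field_simps)
  finally have key: "C\<^sup>2 * (c_norm n m * (R * V2)) \<le> (En / 2)\<^sup>2" .
  have "1 - 16 * (1 / real n + 1 / real m) * h_moment / En\<^sup>2 - 1 / (real K * (1 / (\<epsilon> * N))) - 12 / (minority ^ 4 * R)
    \<le> \<P>(\<omega> in M. T_stat k a0 n m (\<lambda>i. X i \<omega>) (\<lambda>j. Y j \<omega>) > C)"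
    using nm K pos En Rpos N L key by (intro prob_T_stat_gt_ge) auto
  moreover have "16 * (1 / real n + 1 / real m) * h_moment / En\<^sup>2 \<le> 32 / w * (h_moment / (N * En\<^sup>2))"
  proof -
    have "1 / real n \<le> 1 / (w * N)" "1 / real m \<le> 1 / (w * N)"
      using nm N by (intro divide_left_mono; auto)+
    then have "16 * (1 / real n + 1 / real m) \<le> 16 * (1 / (w * N) + 1 / (w * N))"
      by (intro mult_left_mono add_mono) simp_all
    also have "\<dots> = 32 / (w * N)" by simp
    finally have "16 * (1 / real n + 1 / real m) \<le> 32 / (w * N)" .
    moreover have "0 \<le> h_moment" by (simp add: h_moment_def)
    ultimately
    have "16 * (1 / real n + 1 / real m) * (h_moment / En\<^sup>2) \<le> 32 / (w * N) * (h_moment / En\<^sup>2)"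
      by (intro mult_right_mono) auto
    then show ?thesis by (simp add: field_simps)
  qed
  moreover have "1 / (real K * (1 / (\<epsilon> * N))) \<le> 16 / w * \<epsilon>"
  proof -
    have "\<epsilon> * (w * N) \<le> \<epsilon> * (16 * real K)" using KN pos by (intro mult_left_mono) auto
    then show ?thesis using K w by (simp add: field_simps)
  qed
  ultimately show ?thesis by simp
qed

end

theorem theorem20:
  fixes k :: "nat \<Rightarrow> (nat \<Rightarrow> real) \<Rightarrow> (nat \<Rightarrow> real) \<Rightarrow> real"
    and a0 :: "nat \<Rightarrow> real"
    and M :: "nat \<Rightarrow> 'a measure"
    and X Y Z :: "nat \<Rightarrow> nat \<Rightarrow> 'a \<Rightarrow> (nat \<Rightarrow> real)"
    and n m p N :: "nat \<Rightarrow> nat"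
    and \<rho> s \<tau> C :: real
  assumes kernel: "\<And>q. q \<ge> 1 \<Longrightarrow> kernel_on q (k q)"
    and diagonal: "\<And>q x. \<lbrakk>q \<ge> 1; x \<in> space (euclid q)\<rbrakk> \<Longrightarrow> k q x x = a0 q"
    and sampling: "\<And>q. q \<ge> 1 \<Longrightarrow> two_sample (M q) q \<rho> (X q) (Y q) (Z q)"
    and fourth_moment: "\<And>q. q \<ge> 1 \<Longrightarrow> integrable (M q) (\<lambda>\<omega>. (k q (Z q 1 \<omega>) (Z q 2 \<omega>)) ^ 4)"
    and n_lim: "filterlim n at_top sequentially"
    and m_lim: "filterlim m at_top sequentially"
    and p_lim: "filterlim p at_top sequentially"
    and N_eq: "\<And>r. N r = n r + m r"
    and rho: "0 < \<rho>" "\<rho> < 1"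
    and s_pos: "0 < s"
    and ratio: "(\<lambda>r. real (n r) / real (N r) - \<rho>) \<in> O(\<lambda>r. 1 / real (N r) powr s)"
    and tau: "0 < \<tau>" "\<tau> \<le> 1"
    and cond1: "(\<lambda>r. \<bar>energy_dist (M (p r)) (k (p r)) (X (p r)) (Y (p r))\<bar> powr (2 + 2 * \<tau>) /
          (real (N r) powr \<tau> * dvar2 (M (p r)) (k (p r)) (Z (p r)) powr (1 + \<tau>)))
        \<longlonglongrightarrow> 0"
    and cond2: "(\<lambda>r. (\<integral>\<omega>. (k (p r) (Z (p r) 1 \<omega>) (Z (p r) 2 \<omega>))\<^sup>2 \<partial>M (p r)) /
          (real (N r) powr s * dvar2 (M (p r)) (k (p r)) (Z (p r))))
        \<longlonglongrightarrow> 0"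
    and cond3: "(\<lambda>r. (\<integral>\<omega>. \<bar>centered (M (p r)) (k (p r)) (X (p r) 1) (X (p r) 2) \<omega>\<bar> powr (2 + 2 * \<tau>)
              + \<bar>centered (M (p r)) (k (p r)) (X (p r) 1) (Y (p r) 1) \<omega>\<bar> powr (2 + 2 * \<tau>)
              + \<bar>centered (M (p r)) (k (p r)) (Y (p r) 1) (Y (p r) 2) \<omega>\<bar> powr (2 + 2 * \<tau>) \<partial>M (p r)) /
          (real (N r) powr \<tau> * dvar2 (M (p r)) (k (p r)) (Z (p r)) powr (1 + \<tau>)))
        \<longlonglongrightarrow> 0"
    and cond4: "filterlim (\<lambda>r. real (N r) * (energy_dist (M (p r)) (k (p r)) (X (p r)) (Y (p r)))\<^sup>2 /
          (\<integral>\<omega>. (h_kernel (k (p r)) (X (p r) 1 \<omega>) (X (p r) 2 \<omega>)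
                    (Y (p r) 1 \<omega>) (Y (p r) 2 \<omega>))\<^sup>2 \<partial>M (p r)))
        at_top sequentially"
    and cond5: "filterlim (\<lambda>r. real (N r) * energy_dist (M (p r)) (k (p r)) (X (p r)) (Y (p r)) /
          sqrt (dvar2 (M (p r)) (k (p r)) (Z (p r))))
        at_top sequentially"
    and C_pos: "0 < C"
  shows "(\<lambda>r. \<P>(\<omega> in M (p r).
            T_stat (k (p r)) (a0 (p r)) (n r) (m r) (\<lambda>i. X (p r) i \<omega>) (\<lambda>j. Y (p r) j \<omega>) > C))
        \<longlonglongrightarrow> 1"
proof -
  define q where "q = 2 + 2 * \<tau>"
  define En where "En r = energy_dist (M (p r)) (k (p r)) (X (p r)) (Y (p r))" for r
  define V where "V r = dvar2 (M (p r)) (k (p r)) (Z (p r))" for r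
  define H where "H r = (\<integral>\<omega>. (h_kernel (k (p r)) (X (p r) 1 \<omega>) (X (p r) 2 \<omega>)
                    (Y (p r) 1 \<omega>) (Y (p r) 2 \<omega>))\<^sup>2 \<partial>M (p r))" for r
  define A where "A r = (\<integral>\<omega>. \<bar>centered (M (p r)) (k (p r)) (X (p r) 1) (X (p r) 2) \<omega>\<bar> powr q
              + \<bar>centered (M (p r)) (k (p r)) (X (p r) 1) (Y (p r) 1) \<omega>\<bar> powr q
              + \<bar>centered (M (p r)) (k (p r)) (Y (p r) 1) (Y (p r) 2) \<omega>\<bar> powr q \<partial>M (p r))" for r
  define P where "P r = \<P>(\<omega> in M (p r).
            T_stat (k (p r)) (a0 (p r)) (n r) (m r) (\<lambda>i. X (p r) i \<omega>) (\<lambda>j. Y (p r) j \<omega>) > C)" for r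
  define R where "R r = real (N r) * En r / sqrt (V r)" for r
  define u where "u = min \<rho> (1 - \<rho>)"
  define w where "w = u / 2"
  have w: "0 < w" using rho by (simp add: w_def u_def)
  have model: "energy_model (M d) d \<rho> (X d) (Y d) (Z d) (k d) (a0 d)" if "1 \<le> d" for d
    using that sampling[OF that] kernel[OF that] diagonal[OF that] fourth_moment[OF that] rho
    by (auto simp: energy_model_def energy_model_axioms_def kernel_on_def)
  have N_lim: "filterlim (\<lambda>r. real (N r)) at_top sequentially"
    by (rule filterlim_at_top_mono[OF filterlim_compose[OF filterlim_real_sequentially n_lim]])
      (simp add: N_eq)
  have "(\<lambda>r. real (N r) powr (- s)) \<longlonglongrightarrow> 0"
    using s_pos by (intro tendsto_neg_powr N_lim) auto
  then have "(\<lambda>r. 1 / real (N r) powr s) \<in> o(\<lambda>_. 1)"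
    by (intro smalloI_tendsto) (simp_all add: powr_minus field_simps)
  then have "(\<lambda>r. real (n r) / real (N r) - \<rho>) \<in> o(\<lambda>_. 1)"
    by (rule landau_o.big_small_trans[OF ratio])
  then have ratio_lim: "(\<lambda>r. real (n r) / real (N r) - \<rho>) \<longlonglongrightarrow> 0"
    using smalloD_tendsto by fastforce
  have bal: "\<forall>\<^sub>F r in sequentially. w * real (N r) \<le> real (n r) \<and> w * real (N r) \<le> real (m r)"
    using tendstoD[OF ratio_lim w] filterlim_at_top_dense[THEN iffD1, OF N_lim, rule_format, of 0]
  proof eventually_elim
    case (elim r)
    have "\<bar>real (n r) / real (N r) - \<rho>\<bar> < w" using elim by (simp add: dist_real_def)
    moreover have "2 * w \<le> \<rho>" "2 * w \<le> 1 - \<rho>" by (simp_all add: w_def u_def)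
    ultimately have "w \<le> real (n r) / real (N r)" "w \<le> 1 - real (n r) / real (N r)"
      by linarith+
    then show ?case using elim(2) N_eq[of r] by (simp add: field_simps)
  qed
  have R_lim: "filterlim R at_top sequentially"
    using cond5 unfolding R_def En_def V_def .
  have invR: "(\<lambda>r. 1 / R r) \<longlonglongrightarrow> 0"
    using tendsto_inverse_0_at_top[OF R_lim] by (simp add: inverse_eq_divide)
  have "(\<lambda>r. inverse (real (N r) * (En r)\<^sup>2 / H r)) \<longlonglongrightarrow> 0"
    using cond4 unfolding En_def H_def by (rule tendsto_inverse_0_at_top)
  then have H_lim: "(\<lambda>r. H r / (real (N r) * (En r)\<^sup>2)) \<longlonglongrightarrow> 0"
    by simp
  have moment_lim: "(\<lambda>r. (5 powr q * (4 * A r + \<bar>En r\<bar> powr q)) / (real (N r) powr \<tau> * V r powr (1 + \<tau>))) \<longlonglongrightarrow> 0"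
  proof -
    have "(\<lambda>r. 5 powr q * (4 * (A r / (real (N r) powr \<tau> * V r powr (1 + \<tau>)))
        + \<bar>En r\<bar> powr q / (real (N r) powr \<tau> * V r powr (1 + \<tau>)))) \<longlonglongrightarrow> 5 powr q * (4 * 0 + 0)"
      using cond1 cond3 unfolding A_def En_def V_def q_def by (intro tendsto_intros)
    moreover have "c * (4 * (a / d) + b / d) = (c * (4 * a + b)) / d" for a b c d :: real
      by (simp add: add_divide_distrib distrib_left)
    ultimately show ?thesis by (simp only: mult_zero_right add_0_right)
  qed
  have lower: "\<forall>\<^sub>F r in sequentially. 1 - 32 / w * (H r / (real (N r) * (En r)\<^sup>2)) - 16 / w * \<epsilon> - 12 / u ^ 4 * (1 / R r) \<le> P r"
    if eps: "0 < \<epsilon>" for \<epsilon>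
  proof -
    have "\<forall>\<^sub>F r in sequentially. (5 powr q * (4 * A r + \<bar>En r\<bar> powr q)) / (real (N r) powr \<tau> * V r powr (1 + \<tau>)) < 3 * \<epsilon> powr \<tau>"
      using eps by (intro order_tendstoD(2)[OF moment_lim]) simp
    moreover have "\<forall>\<^sub>F r in sequentially. max (48 * C\<^sup>2 / w\<^sup>2) 1 \<le> R r"
      using R_lim unfolding filterlim_at_top by blast
    moreover have "\<forall>\<^sub>F r in sequentially. 4 \<le> n r" "\<forall>\<^sub>F r in sequentially. 4 \<le> m r" "\<forall>\<^sub>F r in sequentially. 1 \<le> p r"
      using n_lim m_lim p_lim unfolding filterlim_at_top by blast+
    ultimately show ?thesis
      using bal
    proof eventually_elim
      case (elim r)
      interpret energy_model "M (p r)" "p r" \<rho> "X (p r)" "Y (p r)" "Z (p r)" "k (p r)" "a0 (p r)"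
        by (rule model) fact
      \<comment> \<open>Otherwise \<open>R r\<close> would be a quotient by zero, hence zero.\<close>
      have "V r \<noteq> 0"
        using elim(2) by (auto simp: R_def)
      then have V: "0 < V r" using V2_nonneg by (simp add: V_def)
      have D: "0 < real (N r) powr \<tau> * V r powr (1 + \<tau>)"
        using V elim(3) by (simp add: N_eq)
      have small: "5 powr q * (4 * A r + \<bar>En r\<bar> powr q) \<le> 3 * \<epsilon> powr \<tau> * (real (N r) powr \<tau> * V r powr (1 + \<tau>))"
        using elim(1) D by (simp add: pos_divide_less_eq)
      have u: "minority = u" by (simp add: minority_def u_def)
      have "4 * centered_moment q = 4 * A r"
        by (simp add: centered_moment_def A_def)
      then show ?case
        using prob_T_stat_gt_ge_moments[of "n r" "m r" \<tau> \<epsilon> C] elim small V tau eps C_pos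
        unfolding P_def R_def H_def h_moment_def En_def[symmetric] V_def[symmetric] u w_def N_eq q_def
        by simp
    qed
  qed
  have "P \<longlonglongrightarrow> 1"
  proof (rule order_tendstoI)
    fix a :: real assume a: "a < 1"
    \<comment> \<open>With this choice \<open>16 / w * \<epsilon>\<close> is half of the gap \<open>1 - a\<close>.\<close>
    define \<epsilon> where "\<epsilon> = w * (1 - a) / 32"
    have eps: "0 < \<epsilon>" using a w by (simp add: \<epsilon>_def)
    have "(\<lambda>r. 1 - 32 / w * (H r / (real (N r) * (En r)\<^sup>2)) - 16 / w * \<epsilon> - 12 / u ^ 4 * (1 / R r))
        \<longlonglongrightarrow> 1 - 32 / w * 0 - 16 / w * \<epsilon> - 12 / u ^ 4 * 0"
      by (intro tendsto_intros H_lim invR)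
    moreover have "a < 1 - 32 / w * 0 - 16 / w * \<epsilon> - 12 / u ^ 4 * 0"
      using a w by (simp add: \<epsilon>_def field_simps)
    ultimately have "\<forall>\<^sub>F r in sequentially. a < 1 - 32 / w * (H r / (real (N r) * (En r)\<^sup>2)) - 16 / w * \<epsilon> - 12 / u ^ 4 * (1 / R r)"
      by (rule order_tendstoD(1))
    then show "\<forall>\<^sub>F r in sequentially. a < P r"
      using lower[OF eps] by eventually_elim simp
  next
    fix a :: real assume a: "1 < a"
    have "\<forall>\<^sub>F r in sequentially. 1 \<le> p r"
      using p_lim unfolding filterlim_at_top by blast
    then show "\<forall>\<^sub>F r in sequentially. P r < a"
    proof eventually_elim
      case (elim r)
      interpret energy_model "M (p r)" "p r" \<rho> "X (p r)" "Y (p r)" "Z (p r)" "k (p r)" "a0 (p r)"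
        by (rule model) fact
      show ?case using a prob_le_1 unfolding P_def by (rule le_less_trans[rotated])
    qed
  qed
  then show ?thesis unfolding P_def .
qed

end
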